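(* Let $G$ be any profinite subgroup of $S_\infty$. Then the existential theory of $G$ (the set of existential first-order sentences in the language of groups true in $G$) is $\Sigma^0_2$ relative to $\deg(T_G)$.
   Context: $S_\infty$ is the group of all permutations of $\mathbb{N}$, with the topology of pointwise convergence; its profinite subgroups are exactly the closed subgroups all of whose orbits are finite. For a subgroup $G\le S_\infty$, $T_G\subseteq\mathbb{N}^{<\omega}$ is the tree of all strings of the form $g(0)g^{-1}(0)g(1)g^{-1}(1)\cdots g(n)g^{-1}(n)$ with $g\in G$, $n\in\mathbb{N}$. $\deg(T_G)$ is the Turing join of the degree of the set $T_G$ (under a fixed computable coding of $\mathbb{N}^{<\omega}$ with decidable immediate-predecessor relation) and the degree of the branching function giving the number of immediate successors of each node of $T_G$. *)

theory Defs
  imports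
    "HOL-Algebra.Bij"
    "HOL-Analysis.T1_Spaces"
    "HOL-Library.Nat_Bijection"
    "HOL-Library.Sublist"
begin

section \<open>Computability relative to an oracle\<close>

text \<open>
  Programs for the partial functions that are \<open>\<mu>\<close>-recursive relative to an oracle
  \<open>nat \<Rightarrow> nat\<close>. Arguments are passed as lists, and the arity of a program is implicit: it
  has no value on lists that are too short. \<open>Prim\<close> recurses on, and \<open>Mu\<close> searches for, the first argument.
\<close>

datatype prog =
    Zero
  | Succ
  | Proj nat
  | Oracle
  | Comp prog "prog list"
  | Prim prog prog
  | Mu prog

inductive evals :: "(nat \<Rightarrow> nat) \<Rightarrow> prog \<Rightarrow> nat list \<Rightarrow> nat \<Rightarrow> bool" for orc where
  evals_Zero: "evals orc Zero xs 0"
| evals_Succ: "evals orc Succ [x] (Suc x)"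
| evals_Proj: "i < length xs \<Longrightarrow> evals orc (Proj i) xs (xs ! i)"
| evals_Oracle: "evals orc Oracle [x] (orc x)"
| evals_Comp: "length ys = length gs \<Longrightarrow> (\<forall>i<length gs. evals orc (gs ! i) xs (ys ! i)) \<Longrightarrow>
    evals orc f ys z \<Longrightarrow> evals orc (Comp f gs) xs z"
| evals_Prim_0: "evals orc f xs z \<Longrightarrow> evals orc (Prim f g) (0 # xs) z"
| evals_Prim_Suc: "evals orc (Prim f g) (n # xs) y \<Longrightarrow> evals orc g (n # y # xs) z \<Longrightarrow>
    evals orc (Prim f g) (Suc n # xs) z"
| evals_Mu: "evals orc f (n # xs) 0 \<Longrightarrow> (\<forall>m<n. \<exists>v. evals orc f (m # xs) (Suc v)) \<Longrightarrow>
    evals orc (Mu f) xs n"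

inductive_cases evals_ZeroE: "evals orc Zero xs y"
inductive_cases evals_SuccE: "evals orc Succ xs y"
inductive_cases evals_ProjE: "evals orc (Proj i) xs y"
inductive_cases evals_OracleE: "evals orc Oracle xs y"
inductive_cases evals_CompE: "evals orc (Comp f gs) xs y"
inductive_cases evals_Prim_0E: "evals orc (Prim f g) (0 # xs) y"
inductive_cases evals_Prim_SucE: "evals orc (Prim f g) (Suc n # xs) y"
inductive_cases evals_MuE: "evals orc (Mu f) xs y"

lemma evals_deterministic:
  assumes "evals orc p xs y" and "evals orc p xs z"
  shows "y = z"
  using assms
proof (induction arbitrary: z rule: evals.induct)
  case (evals_Comp ys gs xs f y)
  from evals_Comp.prems obtain zs where zs: "length zs = length gs"
    "\<forall>i<length gs. evals orc (gs ! i) xs (zs ! i)" "evals orc f zs z"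
    by (rule evals_CompE)
  have "ys = zs"
    using evals_Comp.hyps(1) evals_Comp.IH(1) zs by (intro nth_equalityI) auto
  with zs(3) evals_Comp.IH(2) show ?case by blast
next
  case (evals_Prim_0 f xs y g)
  then show ?case by (blast elim: evals_Prim_0E)
next
  case (evals_Prim_Suc f g n xs u y)
  from evals_Prim_Suc.prems obtain w where
    "evals orc (Prim f g) (n # xs) w" "evals orc g (n # w # xs) z"
    by (rule evals_Prim_SucE)
  with evals_Prim_Suc.IH show ?case by blast
next
  case (evals_Mu f n xs)
  from evals_Mu.prems have z: "evals orc f (z # xs) 0"
    "\<forall>m<z. \<exists>v. evals orc f (m # xs) (Suc v)"
    by (auto elim: evals_MuE)
  show ?case
  proof (rule linorder_cases[of n z])
    assume "n < z"
    with z(2) obtain v where "evals orc f (n # xs) (Suc v)" by blast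
    with evals_Mu.IH(1) show ?thesis by blast
  next
    assume "z < n"
    with evals_Mu.IH(2) obtain v where "\<forall>w. evals orc f (z # xs) w \<longrightarrow> Suc v = w" by blast
    with z(1) show ?thesis by blast
  qed
qed (auto elim: evals_ZeroE evals_SuccE evals_ProjE evals_OracleE)

definition turing_reducible :: "(nat \<Rightarrow> nat) \<Rightarrow> (nat \<Rightarrow> nat) \<Rightarrow> bool" (infix "\<le>\<^sub>T" 50) where
  "f \<le>\<^sub>T g \<longleftrightarrow> (\<exists>p. \<forall>x. evals g p [x] (f x))"

definition turing_degree :: "(nat \<Rightarrow> nat) \<Rightarrow> (nat \<Rightarrow> nat) set" where
  "turing_degree f = {g. f \<le>\<^sub>T g \<and> g \<le>\<^sub>T f}"

definition turing_join :: "(nat \<Rightarrow> nat) \<Rightarrow> (nat \<Rightarrow> nat) \<Rightarrow> nat \<Rightarrow> nat" where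
  "turing_join f g n = (if even n then f (n div 2) else g (n div 2))"

definition decidable3_in :: "(nat \<Rightarrow> nat) \<Rightarrow> (nat \<Rightarrow> nat \<Rightarrow> nat \<Rightarrow> bool) \<Rightarrow> bool" where
  "decidable3_in orc R \<longleftrightarrow> (\<exists>p. \<forall>x y z. evals orc p [x, y, z] (of_bool (R x y z)))"

definition Sigma02_in :: "(nat \<Rightarrow> nat) \<Rightarrow> nat set \<Rightarrow> bool" where
  "Sigma02_in orc S \<longleftrightarrow> (\<exists>R. decidable3_in orc R \<and> S = {n. \<exists>x. \<forall>y. R n x y})"

text \<open>
  It does not matter which representative of the degree serves as the oracle: see
  \<open>Sigma02_in_degree_iff\<close> below.
\<close>

definition Sigma02_in_degree :: "(nat \<Rightarrow> nat) set \<Rightarrow> nat set \<Rightarrow> bool" where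
  "Sigma02_in_degree d S \<longleftrightarrow> (\<forall>orc\<in>d. Sigma02_in orc S)"

primrec subst_oracle :: "prog \<Rightarrow> prog \<Rightarrow> prog" where
  "subst_oracle q Zero = Zero"
| "subst_oracle q Succ = Succ"
| "subst_oracle q (Proj i) = Proj i"
| "subst_oracle q Oracle = q"
| "subst_oracle q (Comp f gs) = Comp (subst_oracle q f) (map (subst_oracle q) gs)"
| "subst_oracle q (Prim f g) = Prim (subst_oracle q f) (subst_oracle q g)"
| "subst_oracle q (Mu f) = Mu (subst_oracle q f)"

lemma evals_subst_oracle:
  assumes "evals f p xs y" and q: "\<And>x. evals g q [x] (f x)"
  shows "evals g (subst_oracle q p) xs y"
  using assms(1)
proof (induction rule: evals.induct)
  case (evals_Mu f n xs)
  then show ?case by (auto intro!: evals.evals_Mu)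
qed (auto intro: evals.intros q)

lemma turing_reducible_refl: "f \<le>\<^sub>T f"
  unfolding turing_reducible_def by (blast intro: evals_Oracle)

lemma turing_reducible_trans:
  assumes "f \<le>\<^sub>T g" and "g \<le>\<^sub>T h"
  shows "f \<le>\<^sub>T h"
proof -
  from assms obtain p q where "\<And>x. evals g p [x] (f x)" "\<And>x. evals h q [x] (g x)"
    unfolding turing_reducible_def by blast
  then have "\<forall>x. evals h (subst_oracle q p) [x] (f x)"
    by (auto intro: evals_subst_oracle)
  then show ?thesis unfolding turing_reducible_def by blast
qed

lemma Sigma02_in_mono:
  assumes "Sigma02_in f S" and "f \<le>\<^sub>T g"
  shows "Sigma02_in g S"
proof -
  from assms obtain R p where S: "S = {n. \<exists>x. \<forall>y. R n x y}"
    and p: "\<And>x y z. evals f p [x, y, z] (of_bool (R x y z))"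
    unfolding Sigma02_in_def decidable3_in_def by blast
  from assms(2) obtain q where q: "\<And>x. evals g q [x] (f x)"
    unfolding turing_reducible_def by blast
  have "\<forall>x y z. evals g (subst_oracle q p) [x, y, z] (of_bool (R x y z))"
    by (intro allI evals_subst_oracle[OF p q])
  with S show ?thesis unfolding Sigma02_in_def decidable3_in_def by blast
qed

lemma Sigma02_in_degree_iff: "Sigma02_in_degree (turing_degree f) S \<longleftrightarrow> Sigma02_in f S"
  unfolding Sigma02_in_degree_def turing_degree_def
  using Sigma02_in_mono turing_reducible_refl by blast


section \<open>First-order logic in the language of groups\<close>

datatype grp_term =
    Var nat
  | One
  | Times grp_term grp_term
  | Inverse grp_term

datatype grp_formula =
    Eq grp_term grp_term
  | Neg grp_formula
  | Conj grp_formula grp_formula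
  | Disj grp_formula grp_formula
  | Exists nat grp_formula
  | Forall nat grp_formula

primrec vars_term :: "grp_term \<Rightarrow> nat set" where
  "vars_term (Var i) = {i}"
| "vars_term One = {}"
| "vars_term (Times s t) = vars_term s \<union> vars_term t"
| "vars_term (Inverse t) = vars_term t"

primrec free_vars :: "grp_formula \<Rightarrow> nat set" where
  "free_vars (Eq s t) = vars_term s \<union> vars_term t"
| "free_vars (Neg \<phi>) = free_vars \<phi>"
| "free_vars (Conj \<phi> \<psi>) = free_vars \<phi> \<union> free_vars \<psi>"
| "free_vars (Disj \<phi> \<psi>) = free_vars \<phi> \<union> free_vars \<psi>"
| "free_vars (Exists i \<phi>) = free_vars \<phi> - {i}"
| "free_vars (Forall i \<phi>) = free_vars \<phi> - {i}"

primrec quantifier_free :: "grp_formula \<Rightarrow> bool" where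
  "quantifier_free (Eq s t) \<longleftrightarrow> True"
| "quantifier_free (Neg \<phi>) \<longleftrightarrow> quantifier_free \<phi>"
| "quantifier_free (Conj \<phi> \<psi>) \<longleftrightarrow> quantifier_free \<phi> \<and> quantifier_free \<psi>"
| "quantifier_free (Disj \<phi> \<psi>) \<longleftrightarrow> quantifier_free \<phi> \<and> quantifier_free \<psi>"
| "quantifier_free (Exists i \<phi>) \<longleftrightarrow> False"
| "quantifier_free (Forall i \<phi>) \<longleftrightarrow> False"

inductive existential :: "grp_formula \<Rightarrow> bool" where
  "quantifier_free \<phi> \<Longrightarrow> existential \<phi>"
| "existential \<phi> \<Longrightarrow> existential (Exists i \<phi>)"

primrec term_value :: "('a, 'b) monoid_scheme \<Rightarrow> (nat \<Rightarrow> 'a) \<Rightarrow> grp_term \<Rightarrow> 'a" where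
  "term_value G v (Var i) = v i"
| "term_value G v One = \<one>\<^bsub>G\<^esub>"
| "term_value G v (Times s t) = term_value G v s \<otimes>\<^bsub>G\<^esub> term_value G v t"
| "term_value G v (Inverse t) = m_inv G (term_value G v t)"

primrec satisfies :: "('a, 'b) monoid_scheme \<Rightarrow> (nat \<Rightarrow> 'a) \<Rightarrow> grp_formula \<Rightarrow> bool" where
  "satisfies G v (Eq s t) \<longleftrightarrow> term_value G v s = term_value G v t"
| "satisfies G v (Neg \<phi>) \<longleftrightarrow> \<not> satisfies G v \<phi>"
| "satisfies G v (Conj \<phi> \<psi>) \<longleftrightarrow> satisfies G v \<phi> \<and> satisfies G v \<psi>"
| "satisfies G v (Disj \<phi> \<psi>) \<longleftrightarrow> satisfies G v \<phi> \<or> satisfies G v \<psi>"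
| "satisfies G v (Exists i \<phi>) \<longleftrightarrow> (\<exists>a\<in>carrier G. satisfies G (v(i := a)) \<phi>)"
| "satisfies G v (Forall i \<phi>) \<longleftrightarrow> (\<forall>a\<in>carrier G. satisfies G (v(i := a)) \<phi>)"

definition true_in :: "('a, 'b) monoid_scheme \<Rightarrow> grp_formula \<Rightarrow> bool" where
  "true_in G \<phi> \<longleftrightarrow> (\<forall>v. range v \<subseteq> carrier G \<longrightarrow> satisfies G v \<phi>)"

definition existential_theory :: "('a, 'b) monoid_scheme \<Rightarrow> grp_formula set" where
  "existential_theory G = {\<phi>. existential \<phi> \<and> free_vars \<phi> = {} \<and> true_in G \<phi>}"

primrec code_term :: "grp_term \<Rightarrow> nat" where
  "code_term (Var i) = prod_encode (0, i)"
| "code_term One = prod_encode (1, 0)"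
| "code_term (Times s t) = prod_encode (2, prod_encode (code_term s, code_term t))"
| "code_term (Inverse t) = prod_encode (3, code_term t)"

primrec goedel_number :: "grp_formula \<Rightarrow> nat" where
  "goedel_number (Eq s t) = prod_encode (0, prod_encode (code_term s, code_term t))"
| "goedel_number (Neg \<phi>) = prod_encode (1, goedel_number \<phi>)"
| "goedel_number (Conj \<phi> \<psi>) =
    prod_encode (2, prod_encode (goedel_number \<phi>, goedel_number \<psi>))"
| "goedel_number (Disj \<phi> \<psi>) =
    prod_encode (3, prod_encode (goedel_number \<phi>, goedel_number \<psi>))"
| "goedel_number (Exists i \<phi>) = prod_encode (4, prod_encode (i, goedel_number \<phi>))"
| "goedel_number (Forall i \<phi>) = prod_encode (5, prod_encode (i, goedel_number \<phi>))"

lemma code_term_inject: "code_term s = code_term t \<longleftrightarrow> s = t"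
proof (induction s arbitrary: t)
  case (Var i) then show ?case by (cases t) auto
next
  case One then show ?case by (cases t) auto
next
  case (Times s1 s2) then show ?case by (cases t) auto
next
  case (Inverse s) then show ?case by (cases t) auto
qed

lemma goedel_number_inject: "goedel_number \<phi> = goedel_number \<psi> \<longleftrightarrow> \<phi> = \<psi>"
proof (induction \<phi> arbitrary: \<psi>)
  case (Eq s t) then show ?case by (cases \<psi>) (auto simp: code_term_inject)
next
  case (Neg \<phi>) then show ?case by (cases \<psi>) auto
next
  case (Conj \<phi>1 \<phi>2) then show ?case by (cases \<psi>) auto
next
  case (Disj \<phi>1 \<phi>2) then show ?case by (cases \<psi>) auto
next
  case (Exists i \<phi>) then show ?case by (cases \<psi>) auto
next
  case (Forall i \<phi>) then show ?case by (cases \<psi>) auto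
qed


section \<open>Profinite permutation groups and their trees\<close>

abbreviation S_infty :: "(nat \<Rightarrow> nat) monoid" where
  "S_infty \<equiv> BijGroup UNIV"

text \<open>
  The topology on \<open>nat \<Rightarrow> nat\<close> is the product topology of the discrete topology on \<open>nat\<close>, so
  \<open>top_of_set (carrier S_infty)\<close> is the topology of pointwise convergence. For subgroups of
  \<open>S_infty\<close> the definition below amounts to compactness (see \<open>profinite_subgroup_iff_compact\<close>);
  the Hausdorff property and total disconnectedness are inherited from \<open>nat \<Rightarrow> nat\<close>.
\<close>

definition profinite_subgroup :: "(nat \<Rightarrow> nat) set \<Rightarrow> bool" where
  "profinite_subgroup G \<longleftrightarrow> subgroup G S_infty \<and>
     closedin (top_of_set (carrier S_infty)) G \<and> (\<forall>n. finite {g n |g. g \<in> G})"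

lemma carrier_S_infty: "carrier S_infty = {g. bij g}"
  by (auto simp: BijGroup_def Bij_def)

lemma inv_S_infty: "bij g \<Longrightarrow> m_inv S_infty g = inv_into UNIV g"
  using inv_BijGroup[of g UNIV] by (simp add: Bij_def restrict_def)

lemma euclidean_nat: "(euclidean :: nat topology) = discrete_topology UNIV"
  by (metis UNIV_I discrete_topology_unique open_discrete open_openin topspace_euclidean)

lemma profinite_subgroup_iff_compact:
  "profinite_subgroup G \<longleftrightarrow> subgroup G S_infty \<and> compact G"
proof (intro iffI conjI)
  assume G: "profinite_subgroup G"
  then show sub: "subgroup G S_infty" by (simp add: profinite_subgroup_def)
  have bijG: "bij g" if "g \<in> G" for g
    using subgroup.subset[OF sub] that carrier_S_infty by auto
  have invG: "inv_into UNIV g \<in> G" if "g \<in> G" for g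
    using subgroup.m_inv_closed[OF sub that] inv_S_infty[OF bijG[OF that]] by simp
  define B where "B n = {g n |g. g \<in> G}" for n
  have finB: "finite (B n)" for n
    using G by (simp add: profinite_subgroup_def B_def)
  have "compactin (product_topology (\<lambda>_. euclidean) UNIV) (PiE UNIV B)"
    by (simp add: compactin_PiE finB finite_imp_compact)
  then have cB: "compact (PiE UNIV B)"
    by (simp add: euclidean_product_topology)
  have "closed G"
    unfolding closed_sequential_limits
  proof (intro allI impI, elim conjE)
    fix X :: "nat \<Rightarrow> nat \<Rightarrow> nat" and g
    assume X: "\<forall>k. X k \<in> G" and lim: "X \<longlonglongrightarrow> g"
    have ev: "\<forall>\<^sub>F k in sequentially. X k n = g n" for n
    proof -
      have "open ((\<lambda>h :: nat \<Rightarrow> nat. h n) -` {g n})"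
        by (intro open_vimage continuous_on_product_coordinates open_discrete)
      from topological_tendstoD[OF lim this] show ?thesis by simp
    qed
    have "inj g"
    proof (rule injI)
      fix m n assume "g m = g n"
      obtain k where "X k m = g m" "X k n = g n"
        using eventually_happens'[OF _ eventually_conj[OF ev[of m] ev[of n]]] by auto
      with \<open>g m = g n\<close> X bijG show "m = n" by (metis bij_is_inj injD)
    qed
    moreover have "n \<in> range g" for n
    proof -
      have "\<forall>\<^sub>F k in sequentially. \<forall>m\<in>B n. X k m = g m"
        using finB ev by (simp add: eventually_ball_finite)
      then obtain k where k: "\<forall>m\<in>B n. X k m = g m"
        using eventually_happens'[OF sequentially_bot] by blast
      let ?m = "inv_into UNIV (X k) n"
      have "?m \<in> B n" using X invG by (auto simp: B_def)
      with k have "g ?m = X k ?m" by simp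
      also have "\<dots> = n" using X bijG by (simp add: bij_is_surj surj_f_inv_f)
      finally show ?thesis by (metis rangeI)
    qed
    ultimately have "g \<in> carrier S_infty"
      by (auto simp: carrier_S_infty bij_def)
    moreover obtain C where "closed C" "G = carrier S_infty \<inter> C"
      using G by (auto simp: profinite_subgroup_def closedin_closed)
    moreover have "g \<in> C"
      using calculation X lim closed_sequentially[of C X g] by auto
    ultimately show "g \<in> G" by simp
  qed
  moreover have "G \<subseteq> PiE UNIV B" by (auto simp: B_def)
  ultimately show "compact G"
    using cB by (metis compact_Int_closed inf.absorb_iff2)
next
  assume G: "subgroup G S_infty \<and> compact G"
  have "finite {g n |g. g \<in> G}" for n
  proof -
    have "compact ((\<lambda>g. g n) ` G)"
      using G by (intro compact_continuous_image)
        (auto intro: continuous_on_subset[OF continuous_on_product_coordinates])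
    then have "compactin (discrete_topology UNIV) ((\<lambda>g. g n) ` G)"
      by (simp flip: euclidean_nat)
    then have "finite ((\<lambda>g. g n) ` G)" by (simp add: compactin_discrete_topology)
    then show ?thesis by (simp add: Setcompr_eq_image)
  qed
  moreover have "closedin (top_of_set (carrier S_infty)) G"
  proof -
    have "Hausdorff_space (product_topology (\<lambda>_ :: nat. discrete_topology (UNIV :: nat set)) UNIV)"
      by (simp add: Hausdorff_space_product_topology Hausdorff_space_discrete_topology)
    then have "Hausdorff_space (euclidean :: (nat \<Rightarrow> nat) topology)"
      by (metis euclidean_nat euclidean_product_topology)
    then have "closed G"
      using G compactin_imp_closedin[of euclidean G] by simp
    then show ?thesis using G by (meson closed_subset subgroup.subset)
  qed
  ultimately show "profinite_subgroup G"
    using G by (simp add: profinite_subgroup_def)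
qed

text \<open>The string \<open>g(0) g\<inverse>(0) g(1) g\<inverse>(1) \<dots> g(n) g\<inverse>(n)\<close>.\<close>

definition perm_string :: "(nat \<Rightarrow> nat) \<Rightarrow> nat \<Rightarrow> nat list" where
  "perm_string g n = concat (map (\<lambda>i. [g i, inv_into UNIV g i]) [0..<Suc n])"

definition perm_tree :: "(nat \<Rightarrow> nat) set \<Rightarrow> nat list set" where
  "perm_tree G = {perm_string g n |g n. g \<in> G}"

text \<open>
  Nodes are ordered by the initial-segment relation. All nodes of \<open>perm_tree G\<close> have even length,
  so immediate successors there are extensions by two entries.
\<close>

definition immediate_successors :: "nat list set \<Rightarrow> nat list \<Rightarrow> nat list set" where
  "immediate_successors T \<sigma> =
     {\<tau> \<in> T. strict_prefix \<sigma> \<tau> \<and> \<not> (\<exists>\<rho>\<in>T. strict_prefix \<sigma> \<rho> \<and> strict_prefix \<rho> \<tau>)}"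

text \<open>Strings are coded by the bijection \<open>list_encode\<close>; \<open>branching\<close> is 0 off the tree.\<close>

definition char_tree :: "nat list set \<Rightarrow> nat \<Rightarrow> nat" where
  "char_tree T c = of_bool (list_decode c \<in> T)"

definition branching :: "nat list set \<Rightarrow> nat \<Rightarrow> nat" where
  "branching T c =
     (if list_decode c \<in> T then card (immediate_successors T (list_decode c)) else 0)"

definition deg_tree :: "nat list set \<Rightarrow> (nat \<Rightarrow> nat) set" where
  "deg_tree T = turing_degree (turing_join (char_tree T) (branching T))"

end

theory Submission
  imports Defs
begin

text \<open>
  An existential sentence \<open>\<exists>x. \<phi>(x)\<close> holds in \<open>G\<close> iff there are a truth value for every equation in \<open>\<phi>\<close>
  making \<open>\<phi>\<close> true, a bound \<open>k\<close>, and elements of \<open>G\<close> satisfying all equations declared true and violating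
  those declared false at an argument below \<open>k\<close>. For fixed truth values and \<open>k\<close> the latter is a closed
  condition on a power of the compact group \<open>G\<close>, so it holds iff for every \<open>n\<close> some tuple of nodes of the
  \<open>n\<close>-th level of the tree does not refute it. That level is finite, and the branching function tells when
  all its nodes have been found, so the last condition is decidable in the tree and its branching
  function. Parsing of Goedel numbers is avoided by guessing the sets of subformula codes together with the
  truth values and checking them locally.
\<close>

section \<open>Functions computable relative to an oracle\<close>

text \<open>The obstacle is the equations declared false: disagreement at some argument is an open
  condition, and compactness preserves only closed ones. Placing the disagreement below
  \<open>k\<close> makes it clopen; one \<open>k\<close> serves all the finitely many equations and
  can be guessed together with the truth values. The guess becomes the existential quantifier of the
  Sigma-2 form, the stage the universal one.

  The nodes chosen at different stages need not extend one another. Elements of \<open>G\<close>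
  through them have a convergent subsequence, and its limit is the assignment sought.

  A node fixes only finitely many values, so at each stage terms are evaluated partially: a value
  has to be recorded only if it and all intermediate values stay below the stage. A stage can
  therefore only fail to refute; along the subsequence every value of the limit is eventually
  recorded.\<close>

text \<open>
  The argument of \<open>f\<close> is an environment assigning values to de Bruijn variables. No arity is recorded:
  the program only has to work on all sufficiently long initial segments of the environment. Under a
  binder the environment \<open>e\<close> is split into \<open>e 0\<close> and \<open>\<lambda>i. e (Suc i)\<close>.
\<close>

definition computable_in :: "(nat \<Rightarrow> nat) \<Rightarrow> ((nat \<Rightarrow> nat) \<Rightarrow> nat) \<Rightarrow> bool" where
  "computable_in orc f \<longleftrightarrow> (\<exists>p k. \<forall>n\<ge>k. \<forall>e. evals orc p (map e [0..<n]) (f e))"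

abbreviation decidable_in :: "(nat \<Rightarrow> nat) \<Rightarrow> ((nat \<Rightarrow> nat) \<Rightarrow> bool) \<Rightarrow> bool" where
  "decidable_in orc P \<equiv> computable_in orc (\<lambda>e. of_bool (P e))"

lemma computable_inI:
  assumes "\<And>n e. k \<le> n \<Longrightarrow> evals orc p (map e [0..<n]) (f e)"
  shows "computable_in orc f"
  using assms unfolding computable_in_def by blast

lemma computable_inE:
  assumes "computable_in orc f"
  obtains p k where "\<And>n e. k \<le> n \<Longrightarrow> evals orc p (map e [0..<n]) (f e)"
  using assms unfolding computable_in_def by blast

text \<open>\<open>case_nat x e\<close> is the environment \<open>e\<close> with \<open>x\<close>
  pushed on top, as seen under a binder.\<close>

lemma map_case_nat: "map (case_nat x e) [0..<Suc n] = x # map e [0..<n]"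
  by (simp add: upt_conv_Cons map_Suc_upt[symmetric] del: upt_Suc)

lemma computable_var: "computable_in orc (\<lambda>e. e i)"
proof (rule computable_inI)
  fix n e assume "Suc i \<le> n"
  then show "evals orc (Proj i) (map e [0..<n]) (e i)"
    using evals_Proj[of i "map e [0..<n]" orc] by simp
qed

text \<open>Composition, renaming and weakening are all instances. The family \<open>s\<close> may
  be infinite because the program of \<open>f\<close> is run on just \<open>k\<close> arguments, so
  only finitely many \<open>s i\<close> enter.\<close>

lemma computable_subst:
  assumes f: "computable_in orc f" and s: "\<And>i. computable_in orc (s i)"
  shows "computable_in orc (\<lambda>e. f (\<lambda>i. s i e))"
proof -
  obtain p k where p: "\<And>n e. k \<le> n \<Longrightarrow> evals orc p (map e [0..<n]) (f e)"
    using f by (rule computable_inE) blast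
  obtain q l where q: "\<And>i n e. l i \<le> n \<Longrightarrow> evals orc (q i) (map e [0..<n]) (s i e)"
    using s unfolding computable_in_def by metis
  show ?thesis
  proof (rule computable_inI)
    fix n e assume n: "(\<Sum>i<k. l i) \<le> n"
    have "l i \<le> n" if "i < k" for i
      using member_le_sum[of i "{..<k}" l] that n by auto
    then have "\<forall>i<k. evals orc (q i) (map e [0..<n]) (s i e)" using q by simp
    then show "evals orc (Comp p (map q [0..<k])) (map e [0..<n]) (f (\<lambda>i. s i e))"
      using p[of k "\<lambda>i. s i e"] by (intro evals_Comp[where ys = "map (\<lambda>i. s i e) [0..<k]"]) auto
  qed
qed

lemma computable_app1:
  assumes "computable_in orc (\<lambda>e. h (e 0))" and "computable_in orc a"
  shows "computable_in orc (\<lambda>e. h (a e))"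
  using computable_subst[OF assms(1), of "\<lambda>_. a"] assms(2) by simp

lemma computable_app2:
  assumes "computable_in orc (\<lambda>e. h (e 0) (e 1))" and "computable_in orc a" "computable_in orc b"
  shows "computable_in orc (\<lambda>e. h (a e) (b e))"
  using computable_subst[OF assms(1), of "\<lambda>i. if i = 0 then a else b"] assms(2,3) by simp

lemma computable_shift2:
  assumes "computable_in orc a"
  shows "computable_in orc (\<lambda>e. a (\<lambda>i. e (Suc (Suc i))))"
  using computable_subst[OF assms computable_var] .

lemma computable_Suc:
  assumes "computable_in orc a"
  shows "computable_in orc (\<lambda>e. Suc (a e))"
proof -
  have "computable_in orc (\<lambda>e. Suc (e 0))"
  proof (rule computable_inI)
    fix n and e :: "nat \<Rightarrow> nat" assume "Suc 0 \<le> n"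
    then show "evals orc (Comp Succ [Proj 0]) (map e [0..<n]) (Suc (e 0))"
      using evals_Proj[of 0 "map e [0..<n]" orc]
      by (intro evals_Comp[where ys = "[e 0]"]) (auto intro: evals_Succ)
  qed
  from computable_app1[OF this assms] show ?thesis .
qed

lemma computable_oracle:
  assumes "computable_in orc a"
  shows "computable_in orc (\<lambda>e. orc (a e))"
proof -
  have "computable_in orc (\<lambda>e. orc (e 0))"
  proof (rule computable_inI)
    fix n and e :: "nat \<Rightarrow> nat" assume "Suc 0 \<le> n"
    then show "evals orc (Comp Oracle [Proj 0]) (map e [0..<n]) (orc (e 0))"
      using evals_Proj[of 0 "map e [0..<n]" orc]
      by (intro evals_Comp[where ys = "[e 0]"]) (auto intro: evals_Oracle)
  qed
  from computable_app1[OF this assms] show ?thesis .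
qed

lemma computable_const: "computable_in orc (\<lambda>e. c)"
proof (induction c)
  case 0
  show ?case by (rule computable_inI[where k = 0 and p = Zero]) (rule evals_Zero)
next
  case (Suc c)
  then show ?case by (rule computable_Suc)
qed

text \<open>The recursion step runs with the counter at index 0 and the accumulator at index 1, as
  in \<open>Prim\<close>; hence the double shift in the second hypothesis.\<close>

lemma computable_rec_nat:
  assumes "computable_in orc a"
    and "computable_in orc (\<lambda>e. g (e 0) (e (Suc 0)) (\<lambda>i. e (Suc (Suc i))))"
    and "computable_in orc b"
  shows "computable_in orc (\<lambda>e. rec_nat (a e) (\<lambda>i y. g i y e) (b e))"
proof -
  obtain p k where p: "\<And>n e. k \<le> n \<Longrightarrow> evals orc p (map e [0..<n]) (a e)"
    using assms(1) by (rule computable_inE) blast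
  obtain q l where q: "\<And>n e. l \<le> n \<Longrightarrow>
      evals orc q (map e [0..<n]) (g (e 0) (e (Suc 0)) (\<lambda>i. e (Suc (Suc i))))"
    using assms(2) by (rule computable_inE) blast
  obtain r m where r: "\<And>n e. m \<le> n \<Longrightarrow> evals orc r (map e [0..<n]) (b e)"
    using assms(3) by (rule computable_inE) blast
  \<comment> \<open>\<open>Prim\<close> is built for exactly \<open>d\<close> parameters; a longer
    environment is cut down to them by projections.\<close>
  define d where "d = max k l"
  have prim: "evals orc (Prim p q) (j # map e [0..<d]) (rec_nat (a e) (\<lambda>i y. g i y e) j)" for j e
  proof (induction j)
    case 0
    then show ?case using p[of d e] by (auto intro: evals_Prim_0 simp: d_def)
  next
    case (Suc j)
    let ?y = "rec_nat (a e) (\<lambda>i y. g i y e) j"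
    have "evals orc q (j # ?y # map e [0..<d]) (g j ?y e)"
      using q[of "Suc (Suc d)" "case_nat j (case_nat ?y e)"]
      by (simp add: map_case_nat d_def del: upt_Suc)
    with Suc show ?case by (auto intro: evals_Prim_Suc)
  qed
  show ?thesis
  proof (rule computable_inI)
    fix n e assume n: "max d m \<le> n"
    have "evals orc (Proj i) (map e [0..<n]) (e i)" if "i < d" for i
      using evals_Proj[of i "map e [0..<n]" orc] that n by simp
    moreover have "evals orc r (map e [0..<n]) (b e)" using r n by simp
    ultimately have "\<forall>i<Suc d. evals orc ((r # map Proj [0..<d]) ! i) (map e [0..<n])
        ((b e # map e [0..<d]) ! i)"
      by (auto simp: nth_Cons split: nat.split)
    then show "evals orc (Comp (Prim p q) (r # map Proj [0..<d])) (map e [0..<n])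
        (rec_nat (a e) (\<lambda>i y. g i y e) (b e))"
      by (intro evals_Comp[OF _ _ prim]) auto
  qed
qed

lemma computable_Least_zero:
  assumes "computable_in orc (\<lambda>e. h (e 0) (\<lambda>i. e (Suc i)))" and ex: "\<And>e. \<exists>n. h n e = (0::nat)"
  shows "computable_in orc (\<lambda>e. LEAST n. h n e = 0)"
proof -
  obtain p k where p: "\<And>n e. k \<le> n \<Longrightarrow>
      evals orc p (map e [0..<n]) (h (e 0) (\<lambda>i. e (Suc i)))"
    using assms(1) by (rule computable_inE) blast
  show ?thesis
  proof (rule computable_inI)
    fix n e assume n: "k \<le> n"
    have p': "evals orc p (j # map e [0..<n]) (h j e)" for j
      using p[of "Suc n" "case_nat j e"] n by (simp add: map_case_nat del: upt_Suc)
    let ?l = "LEAST n. h n e = 0"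
    have "h ?l e = 0" using ex by (rule LeastI_ex)
    then have "evals orc p (?l # map e [0..<n]) 0" using p'[of ?l] by simp
    moreover have "\<exists>v. evals orc p (m # map e [0..<n]) (Suc v)" if "m < ?l" for m
      using p'[of m] not_less_Least[OF that] by (metis not0_implies_Suc)
    ultimately show "evals orc (Mu p) (map e [0..<n]) ?l" by (blast intro: evals_Mu)
  qed
qed

section \<open>Closure under arithmetic, connectives and bounded quantifiers\<close>

named_theorems computable
declare computable_var [computable] computable_const [computable] computable_Suc [computable]

lemma computable_add [computable]:
  assumes "computable_in orc a" "computable_in orc b"
  shows "computable_in orc (\<lambda>e. a e + b e)"
proof -
  have *: "rec_nat x (\<lambda>_ y. Suc y) n = x + n" for x n :: nat by (induction n) auto
  have "computable_in orc (\<lambda>e. rec_nat (a e) (\<lambda>_ y. Suc y) (b e))"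
    by (intro computable_rec_nat assms computable)
  then show ?thesis by (simp add: *)
qed

lemma computable_mult [computable]:
  assumes "computable_in orc a" "computable_in orc b"
  shows "computable_in orc (\<lambda>e. a e * b e)"
proof -
  have *: "rec_nat 0 (\<lambda>_ y. y + x) n = x * n" for x n :: nat by (induction n) auto
  have "computable_in orc (\<lambda>e. rec_nat 0 (\<lambda>_ y. y + a e) (b e))"
    by (rule computable_rec_nat[where g = "\<lambda>_ y e. y + a e"])
      (rule computable assms computable_shift2[OF assms(1)])+
  then show ?thesis by (simp add: *)
qed

lemma computable_diff [computable]:
  assumes "computable_in orc a" "computable_in orc b"
  shows "computable_in orc (\<lambda>e. a e - b e)"
proof -
  have 1: "rec_nat 0 (\<lambda>i _. i) n = n - 1" for n :: nat by (induction n) auto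
  have "computable_in orc (\<lambda>e. rec_nat 0 (\<lambda>i _. i) (e 0))"
    by (intro computable_rec_nat computable)
  then have pred: "computable_in orc (\<lambda>e. e 0 - 1)" by (simp add: 1)
  have 2: "rec_nat x (\<lambda>_ y. y - 1) n = x - n" for x n :: nat by (induction n) auto
  have "computable_in orc (\<lambda>e. rec_nat (a e) (\<lambda>_ y. y - 1) (b e))"
    by (intro computable_rec_nat assms computable_app1[OF pred] computable)
  then show ?thesis by (simp only: 2)
qed

lemma computable_sum:
  assumes "computable_in orc (\<lambda>e. f (e 0) (\<lambda>i. e (Suc i)))" and "computable_in orc b"
  shows "computable_in orc (\<lambda>e. \<Sum>i<b e. f i e)"
proof -
  have *: "rec_nat 0 (\<lambda>i y. y + f i e) n = (\<Sum>i<n. f i e)" for n e by (induction n) auto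
  \<comment> \<open>The renaming steps over index 1, which the accumulator of the recursion
    occupies.\<close>
  have "computable_in orc (\<lambda>e. f (e 0) (\<lambda>i. e (Suc (Suc i))))"
    using computable_subst[OF assms(1), of "\<lambda>i e. e (case_nat 0 (\<lambda>j. Suc (Suc j)) i)"]
    by (simp add: computable)
  then have "computable_in orc (\<lambda>e. rec_nat 0 (\<lambda>i y. y + f i e) (b e))"
    by (intro computable_rec_nat[where g = "\<lambda>i y e. y + f i e"] assms computable)
  then show ?thesis by (simp add: *)
qed

lemma decidable_not [computable]:
  assumes "decidable_in orc P"
  shows "decidable_in orc (\<lambda>e. \<not> P e)"
proof -
  have "computable_in orc (\<lambda>e. 1 - of_bool (P e))" by (intro computable assms)
  moreover have "1 - of_bool b = (of_bool (\<not> b) :: nat)" for b by simp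
  ultimately show ?thesis by (simp only:)
qed

lemma decidable_conj [computable]:
  assumes "decidable_in orc P" "decidable_in orc Q"
  shows "decidable_in orc (\<lambda>e. P e \<and> Q e)"
  using computable_mult[OF assms] by (simp add: of_bool_conj)

lemma decidable_disj [computable]:
  assumes "decidable_in orc P" "decidable_in orc Q"
  shows "decidable_in orc (\<lambda>e. P e \<or> Q e)"
  using decidable_not[OF decidable_conj[OF assms[THEN decidable_not]]] by simp

lemma decidable_imp [computable]:
  assumes "decidable_in orc P" "decidable_in orc Q"
  shows "decidable_in orc (\<lambda>e. P e \<longrightarrow> Q e)"
  using decidable_disj[OF decidable_not[OF assms(1)] assms(2)] by (simp only: imp_conv_disj)

lemma decidable_iff [computable]:
  assumes "decidable_in orc P" "decidable_in orc Q"
  shows "decidable_in orc (\<lambda>e. P e \<longleftrightarrow> Q e)"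
  using decidable_conj[OF decidable_imp[OF assms] decidable_imp[OF assms(2,1)]]
  by (simp only: iff_conv_conj_imp)

lemma decidable_le [computable]:
  assumes "computable_in orc a" "computable_in orc b"
  shows "decidable_in orc (\<lambda>e. a e \<le> b e)"
proof -
  have "computable_in orc (\<lambda>e. 1 - (a e - b e))" by (intro computable assms)
  moreover have "1 - (x - y) = of_bool (x \<le> y)" for x y :: nat by auto
  ultimately show ?thesis by simp
qed

lemma decidable_less [computable]:
  assumes "computable_in orc a" "computable_in orc b"
  shows "decidable_in orc (\<lambda>e. a e < b e)"
  using decidable_le[OF computable_Suc[OF assms(1)] assms(2)] by (simp only: Suc_le_eq)

lemma decidable_eq [computable]:
  assumes "computable_in orc a" "computable_in orc b"
  shows "decidable_in orc (\<lambda>e. a e = b e)"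
  using decidable_conj[OF decidable_le[OF assms] decidable_le[OF assms(2,1)]]
  by (simp only: order_eq_iff)

text \<open>A bounded search succeeds iff the sum of the truth values is positive.\<close>

lemma decidable_ex_less [computable]:
  assumes "decidable_in orc (\<lambda>e. P (e 0) (\<lambda>i. e (Suc i)))" and "computable_in orc b"
  shows "decidable_in orc (\<lambda>e. \<exists>i<b e. P i e)"
proof -
  have "decidable_in orc (\<lambda>e. (0::nat) < (\<Sum>i<b e. of_bool (P i e)))"
    by (rule decidable_less[OF computable_const computable_sum[OF assms]])
  moreover have "(0::nat) < (\<Sum>i<b e. of_bool (P i e)) \<longleftrightarrow> (\<exists>i<b e. P i e)" for e
    by (auto simp: card_gt_0_iff)
  ultimately show ?thesis by simp
qed

lemma decidable_all_less [computable]: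
  assumes "decidable_in orc (\<lambda>e. P (e 0) (\<lambda>i. e (Suc i)))" and "computable_in orc b"
  shows "decidable_in orc (\<lambda>e. \<forall>i<b e. P i e)"
  using decidable_not[OF decidable_ex_less[OF decidable_not[OF assms(1)] assms(2)]] by simp

lemma decidable_ex_le [computable]:
  assumes "decidable_in orc (\<lambda>e. P (e 0) (\<lambda>i. e (Suc i)))" and "computable_in orc b"
  shows "decidable_in orc (\<lambda>e. \<exists>i\<le>b e. P i e)"
  using decidable_ex_less[OF assms(1) computable_Suc[OF assms(2)]] by (simp only: less_Suc_eq_le)

lemma decidable_all_le [computable]:
  assumes "decidable_in orc (\<lambda>e. P (e 0) (\<lambda>i. e (Suc i)))" and "computable_in orc b"
  shows "decidable_in orc (\<lambda>e. \<forall>i\<le>b e. P i e)"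
  using decidable_all_less[OF assms(1) computable_Suc[OF assms(2)]] by (simp only: less_Suc_eq_le)

lemma computable_Least:
  assumes "decidable_in orc (\<lambda>e. P (e 0) (\<lambda>i. e (Suc i)))" and "\<And>e. \<exists>n. P n e"
  shows "computable_in orc (\<lambda>e. LEAST n. P n e)"
  using computable_Least_zero[OF decidable_not[OF assms(1)]] assms(2) by simp

lemma computable_if [computable]:
  assumes "decidable_in orc P" "computable_in orc a" "computable_in orc b"
  shows "computable_in orc (\<lambda>e. if P e then a e else b e)"
proof -
  have "computable_in orc (\<lambda>e. of_bool (P e) * a e + of_bool (\<not> P e) * b e)"
    by (intro computable assms)
  moreover have "of_bool (P e) * a e + of_bool (\<not> P e) * b e = (if P e then a e else b e)" for e
    by simp
  ultimately show ?thesis by simp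
qed

lemma computable_power [computable]:
  assumes "computable_in orc a" "computable_in orc b"
  shows "computable_in orc (\<lambda>e. a e ^ b e)"
proof -
  have *: "rec_nat 1 (\<lambda>_ y. y * x) n = x ^ n" for x n :: nat by (induction n) auto
  have "computable_in orc (\<lambda>e. rec_nat 1 (\<lambda>_ y. y * a e) (b e))"
    by (rule computable_rec_nat[where g = "\<lambda>_ y e. y * a e"])
      (rule computable_const computable_mult computable_var assms computable_shift2[OF assms(1)])+
  then show ?thesis by (simp only: *)
qed

section \<open>Pairs, finite sets and lists coded as numbers\<close>

lemma computable_prod_encode [computable]:
  assumes "computable_in orc a" "computable_in orc b"
  shows "computable_in orc (\<lambda>e. prod_encode (a e, b e))"
proof -
  \<comment> \<open>The triangular numbers in the pairing are defined by a division; the sum avoids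
    it.\<close>
  have *: "(\<Sum>i<n. Suc i) = triangle n" for n by (induction n) auto
  have "computable_in orc (\<lambda>e. (\<Sum>i<e 0 + e 1. Suc i) + e 0)"
    by (intro computable computable_sum)
  then have "computable_in orc (\<lambda>e. prod_encode (e 0, e 1))"
    by (simp only: * prod_encode_def prod.case)
  from computable_app2[where h = "\<lambda>a b. prod_encode (a, b)", OF this assms] show ?thesis .
qed

text \<open>Decoding inverts the pairing by search. The inner quantifier is bounded because
  components never exceed the code; the outer search ends because the pairing is onto.\<close>

lemma computable_fst_prod_decode [computable]:
  assumes "computable_in orc a"
  shows "computable_in orc (\<lambda>e. fst (prod_decode (a e)))"
proof -
  have eq: "prod_encode (fst (prod_decode p), snd (prod_decode p)) = p" for p by simp
  have "computable_in orc (\<lambda>e. LEAST m. \<exists>n\<le>e 0. prod_encode (m, n) = e 0)"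
    by (rule computable_Least, intro computable)
      (metis le_prod_encode_2 eq)
  moreover have "(LEAST m. \<exists>n\<le>p. prod_encode (m, n) = p) = fst (prod_decode p)" for p
    by (rule Least_equality) (metis le_prod_encode_2 eq, auto)
  ultimately have "computable_in orc (\<lambda>e. fst (prod_decode (e 0)))" by simp
  from computable_app1[where h = "\<lambda>p. fst (prod_decode p)", OF this assms] show ?thesis .
qed

lemma computable_snd_prod_decode [computable]:
  assumes "computable_in orc a"
  shows "computable_in orc (\<lambda>e. snd (prod_decode (a e)))"
proof -
  have eq: "prod_encode (fst (prod_decode p), snd (prod_decode p)) = p" for p by simp
  have "computable_in orc (\<lambda>e. LEAST n. \<exists>m\<le>e 0. prod_encode (m, n) = e 0)"
    by (rule computable_Least, intro computable)
      (metis le_prod_encode_1 eq)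
  moreover have "(LEAST n. \<exists>m\<le>p. prod_encode (m, n) = p) = snd (prod_decode p)" for p
    by (rule Least_equality) (metis le_prod_encode_1 eq, auto)
  ultimately have "computable_in orc (\<lambda>e. snd (prod_decode (e 0)))" by simp
  from computable_app1[where h = "\<lambda>p. snd (prod_decode p)", OF this assms] show ?thesis .
qed

text \<open>\<open>set_decode\<close> reads binary digits by division; here an odd quotient and a
  remainder are searched for instead.\<close>

lemma decidable_mem_set_decode [computable]:
  assumes "computable_in orc a" "computable_in orc b"
  shows "decidable_in orc (\<lambda>e. a e \<in> set_decode (b e))"
proof -
  have "decidable_in orc
      (\<lambda>e. \<exists>q\<le>e 1. \<exists>r<2 ^ e 0. e 1 = (2 * q + 1) * 2 ^ e 0 + r)"
    by (intro computable)
  moreover have "(\<exists>q\<le>x. \<exists>r<2 ^ n. x = (2 * q + 1) * 2 ^ n + r) \<longleftrightarrow> n \<in> set_decode x" for n x :: nat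
  proof
    assume "\<exists>q\<le>x. \<exists>r<2 ^ n. x = (2 * q + 1) * 2 ^ n + r"
    then obtain q r where "r < 2 ^ n" "x = (2 * q + 1) * 2 ^ n + r" by blast
    then have "x div 2 ^ n = 2 * q + 1" by (simp only: div_mult_self3 div_less)
    then show "n \<in> set_decode x" by (simp add: set_decode_def)
  next
    assume "n \<in> set_decode x"
    then have "odd (x div 2 ^ n)" by (simp add: set_decode_def)
    then obtain q where q: "x div 2 ^ n = 2 * q + 1" by (rule oddE)
    have "x = (2 * q + 1) * 2 ^ n + x mod 2 ^ n" using div_mult_mod_eq[of x "2 ^ n"] q by simp
    moreover have "q \<le> x" using q div_le_dividend[of x "2 ^ n"] by linarith
    ultimately show "\<exists>q\<le>x. \<exists>r<2 ^ n. x = (2 * q + 1) * 2 ^ n + r"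
      by (meson mod_less_divisor zero_less_numeral zero_less_power)
  qed
  ultimately have "decidable_in orc (\<lambda>e. e 0 \<in> set_decode (e 1))" by simp
  from computable_app2[where h = "\<lambda>m n. of_bool (m \<in> set_decode n)", OF this assms] show ?thesis .
qed

text \<open>A nonempty list is coded by the successor of the pair of its head and the code of its
  tail, hence \<open>d - 1\<close>. The empty list, coded by 0, is its own tail because
  \<open>prod_decode 0\<close> is \<open>(0, 0)\<close>.\<close>

definition drop_code :: "nat \<Rightarrow> nat \<Rightarrow> nat" where
  "drop_code c n = rec_nat c (\<lambda>_ d. snd (prod_decode (d - 1))) n"

definition nth_code :: "nat \<Rightarrow> nat \<Rightarrow> nat" where
  "nth_code c n = fst (prod_decode (drop_code c n - 1))"

lemma list_decode_drop_code: "list_decode (drop_code c n) = drop n (list_decode c)"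
proof (induction n)
  case 0
  then show ?case by (simp add: drop_code_def)
next
  case (Suc n)
  have 0: "prod_decode 0 = (0, 0)" by (simp add: prod_decode_def prod_decode_aux.simps)
  have "list_decode (snd (prod_decode (d - 1))) = tl (list_decode d)" for d
    by (cases d) (auto simp: 0 split: prod.split)
  with Suc show ?case by (simp add: drop_code_def drop_Suc tl_drop)
qed

lemma nth_code_eq:
  assumes "n < length (list_decode c)"
  shows "nth_code c n = list_decode c ! n"
proof -
  have hd: "d \<noteq> 0 \<Longrightarrow> fst (prod_decode (d - 1)) = hd (list_decode d)" for d
    by (cases d) (auto split: prod.split)
  have "drop_code c n \<noteq> 0"
    using assms list_decode_drop_code[of c n] by (metis drop_eq_Nil list_decode.simps(1) not_le)
  from hd[OF this] show ?thesis
    using assms by (simp add: nth_code_def list_decode_drop_code hd_drop_conv_nth)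
qed

lemma computable_drop_code [computable]:
  assumes "computable_in orc a" "computable_in orc b"
  shows "computable_in orc (\<lambda>e. drop_code (a e) (b e))"
  unfolding drop_code_def by (rule computable_rec_nat) (rule computable assms)+

lemma computable_nth_code [computable]:
  assumes "computable_in orc a" "computable_in orc b"
  shows "computable_in orc (\<lambda>e. nth_code (a e) (b e))"
  unfolding nth_code_def by (intro computable assms)

text \<open>The length is recognised as the first index at which \<open>drop_code\<close> becomes
  0.\<close>

lemma decidable_length_list_decode [computable]:
  assumes "computable_in orc a" "computable_in orc b"
  shows "decidable_in orc (\<lambda>e. length (list_decode (a e)) = b e)"
proof -
  have 0: "drop_code c n = 0 \<longleftrightarrow> length (list_decode c) \<le> n" for c n
    by (metis drop_eq_Nil list_decode_drop_code list_decode_inverse list_encode.simps(1) list_decode.simps(1))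
  have "decidable_in orc (\<lambda>e. drop_code (e 0) (e 1) = 0 \<and> (\<forall>j<e 1. drop_code (e 0) j \<noteq> 0))"
    by (intro computable)
  moreover have "(l \<le> n \<and> (\<forall>j<n. \<not> l \<le> j)) \<longleftrightarrow> l = n" for l n :: nat
    using linorder_le_less_linear by (auto simp: le_less)
  ultimately have "decidable_in orc (\<lambda>e. length (list_decode (e 0)) = e 1)" by (simp only: 0)
  from computable_app2[where h = "\<lambda>c n. of_bool (length (list_decode c) = n)", OF this assms]
  show ?thesis .
qed

text \<open>The program may insist on more than three arguments. Padding with zeros is harmless,
  since the value depends on the first three alone.\<close>

lemma decidable3_inI:
  assumes "decidable_in orc (\<lambda>e. R (e 0) (e 1) (e 2))"
  shows "decidable3_in orc R"
proof -
  obtain p k where p: "\<And>n e. k \<le> n \<Longrightarrow>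
      evals orc p (map e [0..<n]) (of_bool (R (e 0) (e 1) (e 2)))"
    using assms by (rule computable_inE) blast
  let ?q = "Comp p (Proj 0 # Proj 1 # Proj 2 # replicate k Zero)"
  have "evals orc ?q [x, y, z] (of_bool (R x y z))" for x y z
  proof (rule evals_Comp)
    let ?e = "\<lambda>i. if i = 0 then x else if i = 1 then y else if i = 2 then z else 0"
    have "map ?e [0..<3 + k] = x # y # z # replicate k 0"
      by (rule nth_equalityI) (auto simp: nth_Cons split: nat.split)
    then show "evals orc p (x # y # z # replicate k 0) (of_bool (R x y z))"
      using p[of "3 + k" ?e] by simp
    show "\<forall>i<length (Proj 0 # Proj 1 # Proj 2 # replicate k Zero).
        evals orc ((Proj 0 # Proj 1 # Proj 2 # replicate k Zero) ! i) [x, y, z]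
          ((x # y # z # replicate k 0) ! i)"
      using evals_Proj[of 0 "[x, y, z]" orc] evals_Proj[of 1 "[x, y, z]" orc]
        evals_Proj[of 2 "[x, y, z]" orc]
      by (auto simp: nth_Cons evals_Zero split: nat.split)
  qed simp
  then show ?thesis unfolding decidable3_in_def by blast
qed

section \<open>Levels of the tree of a permutation group\<close>

lemma length_perm_string: "length (perm_string g n) = 2 * Suc n"
  by (induction n) (auto simp: perm_string_def)

lemma perm_string_Suc: "perm_string g (Suc n) = perm_string g n @ [g (Suc n), inv_into UNIV g (Suc n)]"
  by (simp add: perm_string_def)

lemma take_perm_string:
  "m \<le> n \<Longrightarrow> take (2 * Suc m) (perm_string g n) = perm_string g m"
proof (induction n)
  case 0
  then show ?case by (simp add: length_perm_string)
next
  case (Suc n)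
  then show ?case
    using length_perm_string[of g n] length_perm_string[of g "Suc n"]
    by (cases "m = Suc n") (simp_all add: perm_string_Suc)
qed

lemma nth_perm_string:
  assumes "m \<le> n"
  shows "perm_string g n ! (2 * m) = g m"
proof -
  have "perm_string g m ! (2 * m) = g m"
    using length_perm_string[of g "m - 1"]
    by (cases m) (simp_all add: perm_string_Suc nth_append, simp add: perm_string_def)
  then show ?thesis
    using take_perm_string[OF assms, of g] by (metis lessI mult_Suc_right add_2_eq_Suc less_SucI nth_take)
qed

text \<open>Levels count pairs of entries: \<open>perm_string g n\<close> consists of
  \<open>n + 1\<close> pairs and lies on level \<open>Suc n\<close>, so level 0 of
  \<open>perm_tree G\<close> is empty.\<close>

definition level :: "nat list set \<Rightarrow> nat \<Rightarrow> nat set" where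
  "level T n = {c. list_decode c \<in> T \<and> length (list_decode c) = 2 * n}"

lemma level_perm_tree_iff:
  "c \<in> level (perm_tree G) (Suc n) \<longleftrightarrow> (\<exists>g\<in>G. list_decode c = perm_string g n)"
  by (auto simp: level_def perm_tree_def length_perm_string)

lemma profinite_subgroup_bij:
  assumes "profinite_subgroup G" "g \<in> G"
  shows "bij g"
  using assms subgroup.subset[of G S_infty] by (auto simp: profinite_subgroup_def carrier_S_infty)

lemma profinite_subgroup_inv:
  assumes "profinite_subgroup G" "g \<in> G"
  shows "inv_into UNIV g \<in> G"
  using assms subgroup.m_inv_closed[of G S_infty g] profinite_subgroup_bij[OF assms]
  by (simp add: profinite_subgroup_def inv_S_infty)

text \<open>Since \<open>G\<close> is closed under inverses, both entries of the pair at
  \<open>i\<close> lie in the orbit of \<open>i\<close>, which is finite.\<close>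

lemma finite_level:
  assumes "profinite_subgroup G"
  shows "finite (level (perm_tree G) (Suc n))"
proof -
  define B where "B = (\<Union>i\<le>n. {g i |g. g \<in> G})"
  have "finite B" using assms by (auto simp: B_def profinite_subgroup_def)
  moreover have "list_decode ` level (perm_tree G) (Suc n) \<subseteq> {xs. set xs \<subseteq> B \<and> length xs = 2 * Suc n}"
  proof clarsimp
    fix c assume "c \<in> level (perm_tree G) (Suc n)"
    then obtain g where g: "g \<in> G" "list_decode c = perm_string g n"
      by (auto simp: level_perm_tree_iff)
    have "g i \<in> B" "inv_into UNIV g i \<in> B" if "i \<le> n" for i
      using that g(1) profinite_subgroup_inv[OF assms g(1)] by (auto simp: B_def)
    then have "set (perm_string g n) \<subseteq> B" by (auto simp: perm_string_def)
    then show "set (list_decode c) \<subseteq> B \<and> length (list_decode c) = Suc (Suc (2 * n))"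
      by (simp add: g(2) length_perm_string)
  qed
  ultimately have "finite (list_decode ` level (perm_tree G) (Suc n))"
    using finite_lists_length_eq[of B "2 * Suc n"] finite_subset by blast
  then show ?thesis by (rule finite_imageD) (rule inj_list_decode)
qed

text \<open>Truncating a node to a positive even length gives a node, so an immediate successor is
  just one pair longer; conversely all lengths are even, and no node fits strictly in
  between.\<close>

lemma immediate_successors_perm_tree:
  assumes "c \<in> level (perm_tree G) (Suc n)"
  shows "immediate_successors (perm_tree G) (list_decode c) =
    list_decode ` {d \<in> level (perm_tree G) (Suc (Suc n)). take (2 * Suc n) (list_decode d) = list_decode c}"
    (is "?L = list_decode ` ?R")
proof (intro equalityI subsetI)
  obtain g where g: "g \<in> G" "list_decode c = perm_string g n"
    using assms by (auto simp: level_perm_tree_iff)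
  fix \<tau> assume \<tau>: "\<tau> \<in> ?L"
  then obtain h m where h: "h \<in> G" "\<tau> = perm_string h m"
    by (auto simp: immediate_successors_def perm_tree_def)
  have pre: "strict_prefix (perm_string g n) \<tau>"
    using \<tau> g(2) by (simp add: immediate_successors_def)
  have nm: "n < m"
    using prefix_length_less[OF pre] by (simp add: h(2) length_perm_string)
  have tk: "perm_string g n = perm_string h n"
    using pre nm take_perm_string[of n m h] h(2) length_perm_string[of g n]
    by (metis append_eq_conv_conj less_imp_le prefixE strict_prefix_def)
  have strict: "strict_prefix (perm_string h i) (perm_string h j)" if "i < j" for i j
    using take_perm_string[of i j h] that length_perm_string[of h i] length_perm_string[of h j]
    by (metis less_imp_le nat_neq_iff mult_less_cancel1 Suc_less_eq strict_prefix_def take_is_prefix zero_less_numeral)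
  have "\<not> Suc n < m"
  proof
    assume "Suc n < m"
    then have "strict_prefix (perm_string g n) (perm_string h (Suc n))"
      "strict_prefix (perm_string h (Suc n)) \<tau>"
      using strict[of n "Suc n"] strict[of "Suc n" m] tk h(2) by simp_all
    moreover have "perm_string h (Suc n) \<in> perm_tree G" using h(1) by (auto simp: perm_tree_def)
    ultimately show False using \<tau> g(2) unfolding immediate_successors_def by auto
  qed
  with nm have "m = Suc n" by simp
  then have "list_encode \<tau> \<in> ?R"
    using h g(2) tk take_perm_string[of n "Suc n" h] by (auto simp: level_perm_tree_iff)
  then have "list_decode (list_encode \<tau>) \<in> list_decode ` ?R" by (rule imageI)
  then show "\<tau> \<in> list_decode ` ?R" by (simp only: list_encode_inverse)
next
  fix \<tau> assume "\<tau> \<in> list_decode ` ?R"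
  then obtain d where d: "\<tau> = list_decode d" "d \<in> level (perm_tree G) (Suc (Suc n))"
    "take (2 * Suc n) \<tau> = list_decode c" by auto
  have lc: "length (list_decode c) = 2 * Suc n" using assms by (simp add: level_def)
  have ld: "length \<tau> = 2 * Suc (Suc n)" using d by (simp add: level_def)
  have "strict_prefix (list_decode c) \<tau>"
    unfolding strict_prefix_def using d(3) lc ld take_is_prefix[of "2 * Suc n" \<tau>] by auto
  moreover have "\<not> (strict_prefix (list_decode c) \<rho> \<and> strict_prefix \<rho> \<tau>)" if \<rho>: "\<rho> \<in> perm_tree G" for \<rho>
  proof
    assume *: "strict_prefix (list_decode c) \<rho> \<and> strict_prefix \<rho> \<tau>"
    obtain k where "length \<rho> = 2 * Suc k"
      using \<rho> length_perm_string unfolding perm_tree_def by blast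
    with * prefix_length_less[of "list_decode c" \<rho>] prefix_length_less[of \<rho> \<tau>] lc ld
    show False by simp
  qed
  ultimately show "\<tau> \<in> ?L"
    using d by (auto simp: immediate_successors_def level_def)
qed

section \<open>Counting nodes level by level\<close>

lemma card_level_Suc:
  assumes "profinite_subgroup G"
  shows "card (level (perm_tree G) (Suc (Suc n))) =
    (\<Sum>c\<in>level (perm_tree G) (Suc n). branching (perm_tree G) c)"
proof -
  let ?S = "\<lambda>c. {d \<in> level (perm_tree G) (Suc (Suc n)). take (2 * Suc n) (list_decode d) = list_decode c}"
  have "branching (perm_tree G) c = card (?S c)" if c: "c \<in> level (perm_tree G) (Suc n)" for c
  proof -
    have "branching (perm_tree G) c = card (list_decode ` ?S c)"
      using immediate_successors_perm_tree[OF c] c by (simp add: branching_def level_def)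
    also have "\<dots> = card (?S c)"
      by (rule card_image) (rule inj_list_decode)
    finally show ?thesis .
  qed
  then have "(\<Sum>c\<in>level (perm_tree G) (Suc n). branching (perm_tree G) c) =
      (\<Sum>c\<in>level (perm_tree G) (Suc n). card (?S c))" by simp
  \<comment> \<open>Each longer node has exactly one truncation by a pair, so the fibres
    \<open>?S c\<close> are disjoint and exhaust the next level.\<close>
  also have "\<dots> = card (\<Union>c\<in>level (perm_tree G) (Suc n). ?S c)"
    using finite_level[OF assms] by (intro card_UN_disjoint[symmetric]) (auto simp: inj_eq[OF inj_list_decode])
  also have "(\<Union>c\<in>level (perm_tree G) (Suc n). ?S c) = level (perm_tree G) (Suc (Suc n))"
  proof (intro equalityI subsetI)
    fix d assume d: "d \<in> level (perm_tree G) (Suc (Suc n))"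
    then obtain g where g: "g \<in> G" "list_decode d = perm_string g (Suc n)"
      by (auto simp: level_perm_tree_iff)
    then have "list_encode (perm_string g n) \<in> level (perm_tree G) (Suc n)"
      by (auto simp: level_perm_tree_iff)
    moreover have "d \<in> ?S (list_encode (perm_string g n))"
      using d g(2) take_perm_string[of n "Suc n" g] by simp
    ultimately show "d \<in> (\<Union>c\<in>level (perm_tree G) (Suc n). ?S c)" by blast
  qed auto
  finally show ?thesis ..
qed

text \<open>
  The empty string is not a node of \<open>perm_tree G\<close>, so the oracle does not reveal how many nodes of
  length 2 there are; that number enters the decision procedure as a constant.
\<close>

definition level_bound :: "nat list set \<Rightarrow> nat \<Rightarrow> nat \<Rightarrow> bool" where
  "level_bound T n b \<longleftrightarrow>
     (\<Sum>c<b. of_bool (c \<in> level T 1)) = card (level T 1) \<and>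
     (\<forall>j<n. (\<Sum>c<b. of_bool (c \<in> level T (Suc (Suc j)))) =
        (\<Sum>c<b. if c \<in> level T (Suc j) then branching T c else 0))"

text \<open>Once a whole level is below \<open>b\<close>, its branching numbers add up to the
  cardinality of the next level. The equality of sums then says that the nodes of the next level
  found below \<open>b\<close> are all of them.\<close>

lemma level_less_of_bound:
  assumes G: "profinite_subgroup G" and b: "level_bound (perm_tree G) n b" and "j \<le> n"
  shows "level (perm_tree G) (Suc j) \<subseteq> {..<b}"
  using \<open>j \<le> n\<close>
proof (induction j)
  let ?T = "perm_tree G"
  have full: "level ?T (Suc j) \<subseteq> {..<b}"
    if "(\<Sum>c<b. of_bool (c \<in> level ?T (Suc j))) = card (level ?T (Suc j))" for j
  proof -
    have "card ({..<b} \<inter> level ?T (Suc j)) = card (level ?T (Suc j))"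
      using that by simp
    then have "{..<b} \<inter> level ?T (Suc j) = level ?T (Suc j)"
      by (intro card_subset_eq finite_level[OF G]) auto
    then show ?thesis by blast
  qed
  {
    case 0
    show ?case using b full[of 0] unfolding level_bound_def by simp
  next
    case (Suc j)
    then have sub: "level ?T (Suc j) \<subseteq> {..<b}" by simp
    have "(\<Sum>c<b. of_bool (c \<in> level ?T (Suc (Suc j)))) =
        (\<Sum>c<b. if c \<in> level ?T (Suc j) then branching ?T c else 0)"
      using b Suc.prems unfolding level_bound_def by simp
    also have "\<dots> = (\<Sum>c\<in>{..<b} \<inter> level ?T (Suc j). branching ?T c)"
      by (simp add: sum.inter_restrict)
    also have "{..<b} \<inter> level ?T (Suc j) = level ?T (Suc j)" using sub by blast
    finally show ?case by (intro full) (simp only: card_level_Suc[OF G])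
  }
qed

text \<open>Guarantees that the search for the least bound ends; any \<open>b\<close> above the
  codes of levels 1 to \<open>n + 1\<close> will do.\<close>

lemma ex_level_bound:
  assumes G: "profinite_subgroup G"
  shows "\<exists>b. level_bound (perm_tree G) n b"
proof -
  let ?T = "perm_tree G"
  have "finite (\<Union>j\<le>n. level ?T (Suc j))" using finite_level[OF G] by blast
  then obtain b where "(\<Union>j\<le>n. level ?T (Suc j)) \<subseteq> {..<b}"
    by (metis finite_nat_iff_bounded)
  then have b: "{..<b} \<inter> level ?T (Suc j) = level ?T (Suc j)" if "j \<le> n" for j
    using that by blast
  have "level_bound ?T n b"
    unfolding level_bound_def
  proof (intro conjI allI impI)
    show "(\<Sum>c<b. of_bool (c \<in> level ?T 1)) = card (level ?T 1)"
      using b[of 0] by simp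
    fix j assume j: "j < n"
    have "(\<Sum>c<b. of_bool (c \<in> level ?T (Suc (Suc j)))) = card (level ?T (Suc (Suc j)))"
      using b[of "Suc j"] j by simp
    also have "\<dots> = (\<Sum>c\<in>{..<b} \<inter> level ?T (Suc j). branching ?T c)"
      using b[of j] j by (simp add: card_level_Suc[OF G])
    also have "\<dots> = (\<Sum>c<b. if c \<in> level ?T (Suc j) then branching ?T c else 0)"
      by (simp add: sum.inter_restrict)
    finally show "(\<Sum>c<b. of_bool (c \<in> level ?T (Suc (Suc j)))) =
        (\<Sum>c<b. if c \<in> level ?T (Suc j) then branching ?T c else 0)" .
  qed
  then show ?thesis ..
qed

section \<open>Deciding levels from the tree and its branching function\<close>

abbreviation tree_oracle :: "nat list set \<Rightarrow> nat \<Rightarrow> nat" where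
  "tree_oracle T \<equiv> turing_join (char_tree T) (branching T)"

lemma computable_branching [computable]:
  assumes "computable_in (tree_oracle T) a"
  shows "computable_in (tree_oracle T) (\<lambda>e. branching T (a e))"
proof -
  have "computable_in (tree_oracle T) (\<lambda>e. tree_oracle T (2 * a e + 1))"
    by (intro computable_oracle computable assms)
  then show ?thesis by (simp add: turing_join_def)
qed

lemma decidable_level [computable]:
  assumes "computable_in (tree_oracle T) a" "computable_in (tree_oracle T) b"
  shows "decidable_in (tree_oracle T) (\<lambda>e. a e \<in> level T (b e))"
proof -
  have "decidable_in (tree_oracle T)
      (\<lambda>e. tree_oracle T (2 * a e) = 1 \<and> length (list_decode (a e)) = 2 * b e)"
    by (intro computable_oracle computable assms)
  moreover have "of_bool b = (1::nat) \<longleftrightarrow> b" for b by simp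
  ultimately show ?thesis by (simp add: turing_join_def char_tree_def level_def del: One_nat_def)
qed

lemma decidable_level_bound [computable]:
  assumes "computable_in (tree_oracle T) a" "computable_in (tree_oracle T) b"
  shows "decidable_in (tree_oracle T) (\<lambda>e. level_bound T (a e) (b e))"
proof -
  have "decidable_in (tree_oracle T) (\<lambda>e. level_bound T (e 0) (e 1))"
    unfolding level_bound_def by (intro computable computable_sum)
  from computable_app2[where h = "\<lambda>m n. of_bool (level_bound T m n)", OF this assms] show ?thesis .
qed

section \<open>Semantics in a profinite permutation group\<close>

lemma prod_encode_mono:
  assumes "a \<le> a'" "b \<le> b'"
  shows "prod_encode (a, b) \<le> prod_encode (a', b')"
proof -
  have "mono triangle" by (rule incseq_SucI) simp
  then have "triangle (a + b) \<le> triangle (a' + b')" using assms by (simp add: monoD)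
  with assms show ?thesis by (simp add: prod_encode_def)
qed

text \<open>Drives the inductions on codes. Strictness fails for tag 0, as
  \<open>prod_encode (0, 0) = 0\<close>, but that tag never leads back into the same induction:
  variables are leaves, and equations descend to terms.\<close>

lemma less_prod_encode_2:
  assumes "0 < k"
  shows "a < prod_encode (k, a)"
proof -
  have "n \<le> triangle n" for n by (induction n) auto
  from this[of "k + a"] show ?thesis using assms by (simp add: prod_encode_def)
qed

lemma satisfies_cong:
  "(\<And>i. i \<in> free_vars \<phi> \<Longrightarrow> v i = w i) \<Longrightarrow> satisfies G v \<phi> \<longleftrightarrow> satisfies G w \<phi>"
proof (induction \<phi> arbitrary: v w)
  case (Eq s t)
  have "term_value G v r = term_value G w r" if "\<And>i. i \<in> vars_term r \<Longrightarrow> v i = w i" for r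
    using that by (induction r) auto
  from this[of s] this[of t] Eq show ?case by simp
next
  case (Exists i \<phi>)
  have "satisfies G (v(i := a)) \<phi> \<longleftrightarrow> satisfies G (w(i := a)) \<phi>" for a
    using Exists.prems by (intro Exists.IH) auto
  then show ?case by simp
next
  case (Forall i \<phi>)
  have "satisfies G (v(i := a)) \<phi> \<longleftrightarrow> satisfies G (w(i := a)) \<phi>" for a
    using Forall.prems by (intro Forall.IH) auto
  then show ?case by simp
next
  case (Neg \<phi>)
  from Neg.prems show ?case using Neg.IH[of v w] by simp
next
  case (Conj \<phi>1 \<phi>2)
  from Conj.prems show ?case using Conj.IH(1)[of v w] Conj.IH(2)[of v w] by simp
next
  case (Disj \<phi>1 \<phi>2)
  from Disj.prems show ?case using Disj.IH(1)[of v w] Disj.IH(2)[of v w] by simp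
qed

primrec matrix :: "grp_formula \<Rightarrow> grp_formula" where
  "matrix (Eq s t) = Eq s t"
| "matrix (Neg \<phi>) = Neg \<phi>"
| "matrix (Conj \<phi> \<psi>) = Conj \<phi> \<psi>"
| "matrix (Disj \<phi> \<psi>) = Disj \<phi> \<psi>"
| "matrix (Exists i \<phi>) = matrix \<phi>"
| "matrix (Forall i \<phi>) = Forall i \<phi>"

lemma matrix_quantifier_free: "quantifier_free \<phi> \<Longrightarrow> matrix \<phi> = \<phi>"
  by (cases \<phi>) auto

text \<open>The witnesses are collected in one assignment. If a variable is bound twice, the inner
  witness overwrites the outer one, which is right because the inner binding governs the
  matrix.\<close>

lemma satisfies_matrix:
  assumes "existential \<phi>" "range v \<subseteq> carrier G" "satisfies G v \<phi>"
  obtains w where "range w \<subseteq> carrier G" "satisfies G w (matrix \<phi>)"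
proof -
  have "\<exists>w. range w \<subseteq> carrier G \<and> satisfies G w (matrix \<phi>)"
    using assms
  proof (induction arbitrary: v)
    case (1 \<phi>)
    then show ?case using matrix_quantifier_free by auto
  next
    case (2 \<phi> i)
    from "2.prems" obtain a where a: "a \<in> carrier G" "satisfies G (v(i := a)) \<phi>" by auto
    have "range (v(i := a)) \<subseteq> carrier G" using "2.prems"(1) a(1) by auto
    from "2.IH"[OF this a(2)] show ?case by simp
  qed
  with that show thesis by blast
qed

locale profinite_perm_group =
  fixes G :: "(nat \<Rightarrow> nat) set"
  assumes G: "profinite_subgroup G"
begin

abbreviation H where "H \<equiv> S_infty\<lparr>carrier := G\<rparr>"

lemma mult_profinite:
  assumes "g \<in> G" "h \<in> G"
  shows "g \<otimes>\<^bsub>H\<^esub> h = g \<circ> h"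
proof -
  have "g \<in> Bij UNIV" "h \<in> Bij UNIV"
    using profinite_subgroup_bij[OF G] assms by (simp_all add: Bij_def)
  then show ?thesis by (simp add: BijGroup_def compose_def fun_eq_iff)
qed

lemma inv_profinite:
  assumes "g \<in> G"
  shows "m_inv H g = inv_into UNIV g"
proof -
  have "subgroup G S_infty" using G by (simp add: profinite_subgroup_def)
  from group.m_inv_consistent[OF group_BijGroup this assms] show ?thesis
    by (simp only: inv_S_infty[OF profinite_subgroup_bij[OF G assms]])
qed

lemma term_value_in_profinite:
  assumes "range v \<subseteq> G"
  shows "term_value H v t \<in> G"
proof (induction t)
  case (Var i)
  then show ?case using assms by auto
next
  case One
  then show ?case using subgroup.one_closed[of G S_infty] G by (simp add: profinite_subgroup_def)
next
  case (Times s t)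
  then show ?case using subgroup.m_closed[of G S_infty] G by (simp add: profinite_subgroup_def)
next
  case (Inverse t)
  then show ?case using profinite_subgroup_inv[OF G] by (simp add: inv_profinite)
qed

text \<open>Inverses appear through cancellation because certificates treat the graph of an inverse
  as a converse relation; one law serves soundness, the other completeness.\<close>

lemma term_value_profinite:
  assumes "range v \<subseteq> G"
  shows "term_value H v One m = m"
    and "term_value H v (Times s t) m = term_value H v s (term_value H v t m)"
    and "term_value H v (Inverse t) (term_value H v t m) = m"
    and "term_value H v t (term_value H v (Inverse t) m) = m"
proof -
  show "term_value H v One m = m" by (simp add: BijGroup_def)
  note tG = term_value_in_profinite[OF assms]
  show "term_value H v (Times s t) m = term_value H v s (term_value H v t m)"
    using mult_profinite[OF tG[of s] tG[of t]] by simp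
  have b: "bij (term_value H v t)" using profinite_subgroup_bij[OF G tG] .
  show "term_value H v (Inverse t) (term_value H v t m) = m"
    using b by (simp add: inv_profinite[OF tG] bij_is_inj inv_f_f)
  show "term_value H v t (term_value H v (Inverse t) m) = m"
    using b by (simp add: inv_profinite[OF tG] bij_is_surj surj_f_inv_f)
qed

text \<open>All variables converge at once, by compactness of the countable power of
  \<open>G\<close>. As the factors are discrete, convergence means that each single value is
  eventually constant.\<close>

lemma convergent_subsequence_profinite:
  fixes h :: "nat \<Rightarrow> nat \<Rightarrow> nat \<Rightarrow> nat"
  assumes "\<And>n i. h n i \<in> G"
  obtains v r where "range v \<subseteq> G" "strict_mono r"
    "\<And>i m. \<forall>\<^sub>F n in sequentially. h (r n) i m = v i m"
proof -
  have "compact G" using G by (simp add: profinite_subgroup_iff_compact)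
  then have "compactin (product_topology (\<lambda>_. euclidean) UNIV) (PiE (UNIV :: nat set) (\<lambda>_. G))"
    by (simp add: compactin_PiE)
  then have "compact (PiE (UNIV :: nat set) (\<lambda>_. G))"
    by (simp add: euclidean_product_topology)
  then have "seq_compact (PiE (UNIV :: nat set) (\<lambda>_. G))"
    by (rule compact_imp_seq_compact)
  moreover have "\<forall>n. h n \<in> PiE UNIV (\<lambda>_. G)" using assms by auto
  ultimately obtain v r where v: "v \<in> PiE UNIV (\<lambda>_. G)" and r: "strict_mono (r :: nat \<Rightarrow> nat)"
    and lim: "(h \<circ> r) \<longlonglongrightarrow> v"
    by (rule seq_compactE)
  have "\<forall>\<^sub>F n in sequentially. h (r n) i m = v i m" for i m
  proof -
    have "open ((\<lambda>w :: nat \<Rightarrow> nat \<Rightarrow> nat. w i) -` ((\<lambda>g. g m) -` {v i m}))"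
      by (intro open_vimage continuous_on_product_coordinates open_discrete)
    from topological_tendstoD[OF lim this] show ?thesis by simp
  qed
  with that v r show thesis by (auto simp: PiE_def)
qed

end

section \<open>Certificates\<close>

abbreviation pr :: "nat \<Rightarrow> nat \<Rightarrow> nat" where
  "pr a b \<equiv> prod_encode (a, b)"

text \<open>
  Certificate that \<open>e\<close> codes an existential sentence. \<open>Tm\<close>, \<open>Qf\<close>, \<open>Exs\<close> are sets of codes of terms,
  quantifier-free and existential formulas; \<open>FT\<close>, \<open>FV\<close> contain the pairs (code, free variable) for terms
  and formulas; \<open>W\<close> is a guessed truth table in which existential quantifiers are ignored, since
  the variables are evaluated under one fixed assignment. Every condition is local and in one
  direction only; well-foundedness of the coding does the rest. The truth values of equations are not
  constrained here.
\<close>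

definition syntax_cert ::
  "nat \<Rightarrow> nat set \<Rightarrow> nat set \<Rightarrow> nat set \<Rightarrow> nat set \<Rightarrow> nat set \<Rightarrow> nat set \<Rightarrow> bool" where
  "syntax_cert e Tm Qf Exs W FT FV \<longleftrightarrow>
    (\<forall>c\<le>e. c \<in> Tm \<longrightarrow>
      (\<exists>i\<le>e. c = pr 0 i \<and> pr c i \<in> FT) \<or>
      c = pr 1 0 \<or>
      (\<exists>a\<le>e. \<exists>b\<le>e. c = pr 2 (pr a b) \<and> a \<in> Tm \<and> b \<in> Tm \<and>
        (\<forall>i\<le>e. pr a i \<in> FT \<or> pr b i \<in> FT \<longrightarrow> pr c i \<in> FT)) \<or>
      (\<exists>a\<le>e. c = pr 3 a \<and> a \<in> Tm \<and> (\<forall>i\<le>e. pr a i \<in> FT \<longrightarrow> pr c i \<in> FT))) \<and>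
    (\<forall>c\<le>e. c \<in> Qf \<longrightarrow>
      (\<exists>a\<le>e. \<exists>b\<le>e. c = pr 0 (pr a b) \<and> a \<in> Tm \<and> b \<in> Tm \<and>
        (\<forall>i\<le>e. pr a i \<in> FT \<or> pr b i \<in> FT \<longrightarrow> pr c i \<in> FV)) \<or>
      (\<exists>a\<le>e. c = pr 1 a \<and> a \<in> Qf \<and> (c \<in> W \<longleftrightarrow> \<not> a \<in> W) \<and>
        (\<forall>i\<le>e. pr a i \<in> FV \<longrightarrow> pr c i \<in> FV)) \<or>
      (\<exists>a\<le>e. \<exists>b\<le>e. c = pr 2 (pr a b) \<and> a \<in> Qf \<and> b \<in> Qf \<and>
        (c \<in> W \<longleftrightarrow> a \<in> W \<and> b \<in> W) \<and>
        (\<forall>i\<le>e. pr a i \<in> FV \<or> pr b i \<in> FV \<longrightarrow> pr c i \<in> FV)) \<or>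
      (\<exists>a\<le>e. \<exists>b\<le>e. c = pr 3 (pr a b) \<and> a \<in> Qf \<and> b \<in> Qf \<and>
        (c \<in> W \<longleftrightarrow> a \<in> W \<or> b \<in> W) \<and>
        (\<forall>i\<le>e. pr a i \<in> FV \<or> pr b i \<in> FV \<longrightarrow> pr c i \<in> FV))) \<and>
    (\<forall>c\<le>e. c \<in> Exs \<longrightarrow>
      c \<in> Qf \<or>
      (\<exists>j\<le>e. \<exists>a\<le>e. c = pr 4 (pr j a) \<and> a \<in> Exs \<and> (c \<in> W \<longleftrightarrow> a \<in> W) \<and>
        (\<forall>i\<le>e. pr a i \<in> FV \<and> \<not> i = j \<longrightarrow> pr c i \<in> FV))) \<and>
    e \<in> Exs \<and> e \<in> W \<and> (\<forall>i\<le>e. \<not> pr e i \<in> FV)"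

text \<open>
  At stage \<open>n\<close>, \<open>Q\<close> is a set of triples (code of a term, \<open>m\<close>, value at \<open>m\<close>) with \<open>m\<close> and the value
  below \<open>n\<close>, containing at least what follows from one node of length \<open>2 * n\<close> for each variable. It must not
  refute any equation declared true by \<open>W\<close>, nor verify at all arguments below \<open>k\<close> an equation declared
  false.
\<close>

definition graph_cert ::
  "nat list set \<Rightarrow> nat \<Rightarrow> nat \<Rightarrow> nat set \<Rightarrow> nat set \<Rightarrow> nat \<Rightarrow> nat \<Rightarrow> nat set \<Rightarrow> bool" where
  "graph_cert T e k Qf W n bnd Q \<longleftrightarrow>
    (\<forall>i\<le>e. pr 0 i \<le> e \<longrightarrow>
      (\<exists>s<bnd. s \<in> level T n \<and>
        (\<forall>m<n. nth_code s (2 * m) < n \<longrightarrow> pr (pr 0 i) (pr m (nth_code s (2 * m))) \<in> Q))) \<and>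
    (pr 1 0 \<le> e \<longrightarrow> (\<forall>m<n. pr (pr 1 0) (pr m m) \<in> Q)) \<and>
    (\<forall>a\<le>e. \<forall>b\<le>e. pr 2 (pr a b) \<le> e \<longrightarrow>
      (\<forall>m<n. \<forall>j<n. \<forall>v<n. pr b (pr m j) \<in> Q \<and> pr a (pr j v) \<in> Q \<longrightarrow>
        pr (pr 2 (pr a b)) (pr m v) \<in> Q)) \<and>
    (\<forall>a\<le>e. pr 3 a \<le> e \<longrightarrow>
      (\<forall>m<n. \<forall>j<n. pr a (pr j m) \<in> Q \<longrightarrow> pr (pr 3 a) (pr m j) \<in> Q)) \<and>
    (\<forall>a\<le>e. \<forall>b\<le>e. pr 0 (pr a b) \<le> e \<and> pr 0 (pr a b) \<in> Qf \<longrightarrow>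
      (pr 0 (pr a b) \<in> W \<longrightarrow>
        (\<forall>m<n. \<forall>v<n. \<forall>u<n. pr a (pr m v) \<in> Q \<and> pr b (pr m u) \<in> Q \<longrightarrow> v = u)) \<and>
      (\<not> pr 0 (pr a b) \<in> W \<longrightarrow>
        (\<exists>m<k. \<not> (\<exists>v<n. pr a (pr m v) \<in> Q \<and> pr b (pr m v) \<in> Q))))"

text \<open>Makes the quantifier over the set \<open>Q\<close> of a stage a bounded one.\<close>

lemma set_encode_less:
  assumes "A \<subseteq> {..<n}"
  shows "set_encode A < 2 ^ n"
proof -
  have "set_encode A \<le> (\<Sum>i = 0..<n. 2 ^ i)"
    unfolding set_encode_def using assms by (intro sum_mono2) auto
  also have "\<dots> < 2 ^ n" by (simp add: sum_power2)
  finally show ?thesis .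
qed

lemma ex_leI: "a \<le> e \<Longrightarrow> P a \<Longrightarrow> \<exists>x\<le>e. P x" for a e :: nat
  by blast

section \<open>Soundness of certificates\<close>

context profinite_perm_group
begin

text \<open>The elements of \<open>G\<close> supplied by the stages converge along a subsequence to
  an assignment \<open>v\<close>. The values of each certified term under \<open>v\<close> lie in
  \<open>Q\<close> at all late stages of the subsequence, which forces the equations to have under
  \<open>v\<close> the truth values given by \<open>W\<close>.\<close>

lemma cert_sound:
  assumes syn: "syntax_cert e Tm Qf Exs W FT FV"
    and graph: "\<And>n. graph_cert (perm_tree G) e k Qf W (Suc n) (bnd n) (Q n)"
  shows "e \<in> goedel_number ` existential_theory H"
proof -
  note syn' = syn[unfolded syntax_cert_def]
  note tm_cert = syn'[THEN conjunct1]
    and qf_cert = syn'[THEN conjunct2, THEN conjunct1]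
    and ex_cert = syn'[THEN conjunct2, THEN conjunct2, THEN conjunct1]
    and sentence_cert = syn'[THEN conjunct2, THEN conjunct2, THEN conjunct2]
  note graph' = graph[unfolded graph_cert_def]
  note var_graph = graph'[THEN conjunct1]
    and one_graph = graph'[THEN conjunct2, THEN conjunct1]
    and times_graph = graph'[THEN conjunct2, THEN conjunct2, THEN conjunct1]
    and inverse_graph = graph'[THEN conjunct2, THEN conjunct2, THEN conjunct2, THEN conjunct1]
    and eq_graph = graph'[THEN conjunct2, THEN conjunct2, THEN conjunct2, THEN conjunct2]
  have "\<exists>g\<in>G. pr 0 i \<le> e \<longrightarrow> (\<forall>m<Suc n. g m < Suc n \<longrightarrow> pr (pr 0 i) (pr m (g m)) \<in> Q n)" for n i
  proof (cases "pr 0 i \<le> e")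
    case True
    then have "i \<le> e" using le_prod_encode_2[of i 0] by linarith
    with True var_graph[of n] obtain s where s: "s \<in> level (perm_tree G) (Suc n)"
      "\<forall>m<Suc n. nth_code s (2 * m) < Suc n \<longrightarrow> pr (pr 0 i) (pr m (nth_code s (2 * m))) \<in> Q n"
      by blast
    from s(1) obtain g where g: "g \<in> G" "list_decode s = perm_string g n"
      by (auto simp: level_perm_tree_iff)
    have "nth_code s (2 * m) = g m" if "m < Suc n" for m
      using that nth_code_eq[of "2 * m" s] nth_perm_string[of m n g]
      by (simp add: g(2) length_perm_string)
    with s(2) g(1) show ?thesis by auto
  next
    \<comment> \<open>A variable whose code exceeds \<open>e\<close> gets the identity, so that
      \<open>h\<close> is total.\<close>
    case False
    then show ?thesis using subgroup.one_closed[of G S_infty] G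
      by (auto simp: profinite_subgroup_def)
  qed
  then have "\<exists>h. \<forall>n i. h n i \<in> G \<and>
      (pr 0 i \<le> e \<longrightarrow> (\<forall>m<Suc n. h n i m < Suc n \<longrightarrow> pr (pr 0 i) (pr m (h n i m)) \<in> Q n))"
    by (intro choice allI) blast
  then obtain h where hG: "\<And>n i. h n i \<in> G"
    and hQ: "\<And>n i m. pr 0 i \<le> e \<Longrightarrow> m < Suc n \<Longrightarrow> h n i m < Suc n \<Longrightarrow>
      pr (pr 0 i) (pr m (h n i m)) \<in> Q n"
    by blast
  obtain v r where v: "range v \<subseteq> G" and r: "strict_mono r"
    and lim: "\<And>i m. \<forall>\<^sub>F n in sequentially. h (r n) i m = v i m"
    by (rule convergent_subsequence_profinite[of h, OF hG]) blast
  \<comment> \<open>\<open>Q\<close> only promises triples with entries below the stage; every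
    number is below all late stages.\<close>
  have large: "\<forall>\<^sub>F n in sequentially. x < Suc (r n)" for x
    using eventually_ge_at_top[of x]
    by eventually_elim (use strict_mono_imp_increasing[OF r] in \<open>auto intro: le_trans simp: less_Suc_eq_le\<close>)
  have tm: "\<exists>t. code_term t = c \<and> vars_term t \<subseteq> {i. i \<le> e \<and> pr c i \<in> FT} \<and>
      (\<forall>m. \<forall>\<^sub>F n in sequentially. pr c (pr m (term_value H v t m)) \<in> Q (r n))"
    if "c \<le> e" "c \<in> Tm" for c
    using that
  proof (induction c rule: less_induct)
    case (less c)
    from tm_cert[rule_format, OF less.prems] consider
        (var) i where "i \<le> e" "c = pr 0 i" "pr c i \<in> FT"
      | (one) "c = pr 1 0"
      | (times) a b where "c = pr 2 (pr a b)" "a \<in> Tm" "b \<in> Tm"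
          "\<forall>i\<le>e. pr a i \<in> FT \<or> pr b i \<in> FT \<longrightarrow> pr c i \<in> FT"
      | (inverse) a where "c = pr 3 a" "a \<in> Tm" "\<forall>i\<le>e. pr a i \<in> FT \<longrightarrow> pr c i \<in> FT"
      by blast
    then show ?case
    proof cases
      case var
      have "\<forall>\<^sub>F n in sequentially. pr c (pr m (v i m)) \<in> Q (r n)" for m
        using lim[of i m] large[of m] large[of "v i m"]
      proof eventually_elim
        case (elim n)
        with hQ[of i m "r n"] var(2) less.prems(1) show ?case by simp
      qed
      then show ?thesis using var by (intro exI[of _ "Var i"]) auto
    next
      case one
      have "\<forall>\<^sub>F n in sequentially. pr c (pr m m) \<in> Q (r n)" for m
        using large[of m]
        by eventually_elim (use one_graph one less.prems in auto)
      then show ?thesis using one term_value_profinite(1)[OF v]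
        by (intro exI[of _ One]) (auto simp del: term_value.simps)
    next
      case times
      have ab: "a < c" "b < c"
        using times(1) less_prod_encode_2[of 2 "pr a b"] le_prod_encode_1[of a b] le_prod_encode_2[of b a]
        by linarith+
      with less.prems have abe: "a \<le> e" "b \<le> e" by auto
      obtain s where s: "code_term s = a" "vars_term s \<subseteq> {i. i \<le> e \<and> pr a i \<in> FT}"
        "\<And>m. \<forall>\<^sub>F n in sequentially. pr a (pr m (term_value H v s m)) \<in> Q (r n)"
        using less.IH[OF ab(1) abe(1) times(2)] by blast
      obtain t where t: "code_term t = b" "vars_term t \<subseteq> {i. i \<le> e \<and> pr b i \<in> FT}"
        "\<And>m. \<forall>\<^sub>F n in sequentially. pr b (pr m (term_value H v t m)) \<in> Q (r n)"
        using less.IH[OF ab(2) abe(2) times(3)] by blast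
      have "\<forall>\<^sub>F n in sequentially. pr c (pr m (term_value H v (Times s t) m)) \<in> Q (r n)" for m
      proof -
        let ?j = "term_value H v t m"
        let ?w = "term_value H v s ?j"
        show ?thesis
          using t(3)[of m] s(3)[of ?j] large[of m] large[of ?j] large[of ?w]
        proof eventually_elim
          case (elim n)
          have "\<forall>m<Suc (r n). \<forall>j<Suc (r n). \<forall>v<Suc (r n).
              pr b (pr m j) \<in> Q (r n) \<and> pr a (pr j v) \<in> Q (r n) \<longrightarrow> pr c (pr m v) \<in> Q (r n)"
            using times_graph[rule_format, OF abe] times(1) less.prems(1) by blast
          with elim show ?case unfolding term_value_profinite(2)[OF v] by blast
        qed
      qed
      then show ?thesis using s t times(1,4)
        by (intro exI[of _ "Times s t"]) (auto simp del: term_value.simps)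
    next
      case inverse
      have a: "a < c" using inverse(1) less_prod_encode_2[of 3 a] by simp
      with less.prems have ae: "a \<le> e" by auto
      obtain t where t: "code_term t = a" "vars_term t \<subseteq> {i. i \<le> e \<and> pr a i \<in> FT}"
        "\<And>m. \<forall>\<^sub>F n in sequentially. pr a (pr m (term_value H v t m)) \<in> Q (r n)"
        using less.IH[OF a ae inverse(2)] by blast
      have "\<forall>\<^sub>F n in sequentially. pr c (pr m (term_value H v (Inverse t) m)) \<in> Q (r n)" for m
      proof -
        \<comment> \<open>The inverse is read backwards: the triple of \<open>t\<close> at
          \<open>?j\<close> with value \<open>m\<close> is recorded, and the certificate then
          demands the converse triple.\<close>
        let ?j = "term_value H v (Inverse t) m"
        show ?thesis
          using t(3)[of ?j, unfolded term_value_profinite(4)[OF v]] large[of m] large[of ?j]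
        proof eventually_elim
          case (elim n)
          have "\<forall>m<Suc (r n). \<forall>j<Suc (r n). pr a (pr j m) \<in> Q (r n) \<longrightarrow> pr c (pr m j) \<in> Q (r n)"
            using inverse_graph[rule_format, OF ae] inverse(1) less.prems(1) by blast
          with elim show ?case by blast
        qed
      qed
      then show ?thesis using t inverse(1,3)
        by (intro exI[of _ "Inverse t"]) (auto simp del: term_value.simps)
    qed
  qed
  have atom: "term_value H v s = term_value H v t \<longleftrightarrow> c \<in> W"
    if c: "c = pr 0 (pr a b)" "c \<le> e" "c \<in> Qf" "a \<le> e" "b \<le> e"
      and s: "\<And>m. \<forall>\<^sub>F n in sequentially. pr a (pr m (term_value H v s m)) \<in> Q (r n)"
      and t: "\<And>m. \<forall>\<^sub>F n in sequentially. pr b (pr m (term_value H v t m)) \<in> Q (r n)"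
    for a b c s t
  proof
    assume st: "term_value H v s = term_value H v t"
    show "c \<in> W"
    proof (rule ccontr)
      assume "c \<notin> W"
      then have ex: "\<exists>m<k. \<not> (\<exists>v<Suc (r n). pr a (pr m v) \<in> Q (r n) \<and> pr b (pr m v) \<in> Q (r n))" for n
        using eq_graph[rule_format, of a b "r n"] c by simp
      have "\<forall>\<^sub>F n in sequentially. \<exists>v<Suc (r n). pr a (pr m v) \<in> Q (r n) \<and> pr b (pr m v) \<in> Q (r n)" for m
        using s[of m] t[of m] large[of "term_value H v t m"]
        by eventually_elim (use st in auto)
      \<comment> \<open>\<open>k\<close> does not depend on the stage, so finitely many eventual
        statements combine into one.\<close>
      then have "\<forall>\<^sub>F n in sequentially. \<forall>m\<in>{..<k}. \<exists>v<Suc (r n). pr a (pr m v) \<in> Q (r n) \<and> pr b (pr m v) \<in> Q (r n)"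
        by (intro eventually_ball_finite) auto
      then obtain n where "\<forall>m\<in>{..<k}. \<exists>v<Suc (r n). pr a (pr m v) \<in> Q (r n) \<and> pr b (pr m v) \<in> Q (r n)"
        using eventually_happens'[OF sequentially_bot] by blast
      with ex[of n] show False by blast
    qed
  next
    assume W: "c \<in> W"
    show "term_value H v s = term_value H v t"
    proof
      fix m
      have "\<forall>\<^sub>F n in sequentially. term_value H v s m = term_value H v t m"
        using s[of m] t[of m] large[of m] large[of "term_value H v s m"] large[of "term_value H v t m"]
      proof eventually_elim
        case (elim n)
        have "\<forall>m<Suc (r n). \<forall>v<Suc (r n). \<forall>u<Suc (r n).
            pr a (pr m v) \<in> Q (r n) \<and> pr b (pr m u) \<in> Q (r n) \<longrightarrow> v = u"
          using eq_graph[rule_format, of a b "r n"] c W by simp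
        with elim show ?case by blast
      qed
      then show "term_value H v s m = term_value H v t m" by simp
    qed
  qed
  have qfree: "\<exists>\<psi>. goedel_number \<psi> = c \<and> quantifier_free \<psi> \<and>
      free_vars \<psi> \<subseteq> {i. i \<le> e \<and> pr c i \<in> FV} \<and> (satisfies H v \<psi> \<longleftrightarrow> c \<in> W)"
    if "c \<le> e" "c \<in> Qf" for c
    using that
  proof (induction c rule: less_induct)
    case (less c)
    have sub: "a < c" "b < c" if "c = pr k (pr a b)" "0 < k" for a b k
      using that less_prod_encode_2[of k "pr a b"] le_prod_encode_1[of a b] le_prod_encode_2[of b a]
      by linarith+
    from qf_cert[rule_format, OF less.prems] consider
        (eq) a b where "a \<le> e" "b \<le> e" "c = pr 0 (pr a b)" "a \<in> Tm" "b \<in> Tm"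
          "\<forall>i\<le>e. pr a i \<in> FT \<or> pr b i \<in> FT \<longrightarrow> pr c i \<in> FV"
      | (neg) a where "c = pr 1 a" "a \<in> Qf" "c \<in> W \<longleftrightarrow> \<not> a \<in> W"
          "\<forall>i\<le>e. pr a i \<in> FV \<longrightarrow> pr c i \<in> FV"
      | (conj) a b where "c = pr 2 (pr a b)" "a \<in> Qf" "b \<in> Qf" "c \<in> W \<longleftrightarrow> a \<in> W \<and> b \<in> W"
          "\<forall>i\<le>e. pr a i \<in> FV \<or> pr b i \<in> FV \<longrightarrow> pr c i \<in> FV"
      | (disj) a b where "c = pr 3 (pr a b)" "a \<in> Qf" "b \<in> Qf" "c \<in> W \<longleftrightarrow> a \<in> W \<or> b \<in> W"
          "\<forall>i\<le>e. pr a i \<in> FV \<or> pr b i \<in> FV \<longrightarrow> pr c i \<in> FV"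
      by blast
    then show ?case
    proof cases
      case eq
      from tm[OF eq(1,4)] obtain s where s: "code_term s = a"
        "vars_term s \<subseteq> {i. i \<le> e \<and> pr a i \<in> FT}"
        "\<And>m. \<forall>\<^sub>F n in sequentially. pr a (pr m (term_value H v s m)) \<in> Q (r n)" by blast
      from tm[OF eq(2,5)] obtain t where t: "code_term t = b"
        "vars_term t \<subseteq> {i. i \<le> e \<and> pr b i \<in> FT}"
        "\<And>m. \<forall>\<^sub>F n in sequentially. pr b (pr m (term_value H v t m)) \<in> Q (r n)" by blast
      have "satisfies H v (Eq s t) \<longleftrightarrow> c \<in> W"
        using atom[OF eq(3) less.prems eq(1,2) s(3) t(3)] by simp
      then show ?thesis using eq s t by (intro exI[of _ "Eq s t"]) (auto simp del: satisfies.simps)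
    next
      case neg
      have a: "a < c" using neg(1) less_prod_encode_2[of 1 a] by simp
      with less.prems less.IH[OF a _ neg(2)] obtain \<psi> where "goedel_number \<psi> = a"
        "quantifier_free \<psi>" "free_vars \<psi> \<subseteq> {i. i \<le> e \<and> pr a i \<in> FV}" "satisfies H v \<psi> \<longleftrightarrow> a \<in> W"
        by auto
      then show ?thesis using neg by (intro exI[of _ "Neg \<psi>"]) auto
    next
      case conj
      note ab = sub[OF conj(1)]
      with less.prems less.IH[OF ab(1) _ conj(2)] obtain \<psi> where "goedel_number \<psi> = a"
        "quantifier_free \<psi>" "free_vars \<psi> \<subseteq> {i. i \<le> e \<and> pr a i \<in> FV}" "satisfies H v \<psi> \<longleftrightarrow> a \<in> W"
        by auto
      moreover from ab less.prems less.IH[OF ab(2) _ conj(3)] obtain \<chi> where "goedel_number \<chi> = b"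
        "quantifier_free \<chi>" "free_vars \<chi> \<subseteq> {i. i \<le> e \<and> pr b i \<in> FV}" "satisfies H v \<chi> \<longleftrightarrow> b \<in> W"
        by auto
      ultimately show ?thesis using conj by (intro exI[of _ "Conj \<psi> \<chi>"]) auto
    next
      case disj
      note ab = sub[OF disj(1)]
      with less.prems less.IH[OF ab(1) _ disj(2)] obtain \<psi> where "goedel_number \<psi> = a"
        "quantifier_free \<psi>" "free_vars \<psi> \<subseteq> {i. i \<le> e \<and> pr a i \<in> FV}" "satisfies H v \<psi> \<longleftrightarrow> a \<in> W"
        by auto
      moreover from ab less.prems less.IH[OF ab(2) _ disj(3)] obtain \<chi> where "goedel_number \<chi> = b"
        "quantifier_free \<chi>" "free_vars \<chi> \<subseteq> {i. i \<le> e \<and> pr b i \<in> FV}" "satisfies H v \<chi> \<longleftrightarrow> b \<in> W"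
        by auto
      ultimately show ?thesis using disj by (intro exI[of _ "Disj \<psi> \<chi>"]) auto
    qed
  qed
  \<comment> \<open>Only one implication can be expected: the table ignores quantifiers, so
    \<open>c \<notin> W\<close> does not exclude witnesses other than those in \<open>v\<close>. For
    a true entry, \<open>v j\<close> is a witness.\<close>
  have ex: "\<exists>\<psi>. goedel_number \<psi> = c \<and> existential \<psi> \<and>
      free_vars \<psi> \<subseteq> {i. i \<le> e \<and> pr c i \<in> FV} \<and> (c \<in> W \<longrightarrow> satisfies H v \<psi>)"
    if "c \<le> e" "c \<in> Exs" for c
    using that
  proof (induction c rule: less_induct)
    case (less c)
    from ex_cert[rule_format, OF less.prems] consider
        (qf) "c \<in> Qf"
      | (exists) j a where "c = pr 4 (pr j a)" "a \<in> Exs" "c \<in> W \<longleftrightarrow> a \<in> W"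
          "\<forall>i\<le>e. pr a i \<in> FV \<and> \<not> i = j \<longrightarrow> pr c i \<in> FV"
      by blast
    then show ?case
    proof cases
      case qf
      with qfree[OF less.prems(1)] show ?thesis
        by (blast intro: existential.intros)
    next
      case exists
      have a: "a < c"
        using exists(1) less_prod_encode_2[of 4 "pr j a"] le_prod_encode_2[of a j] by linarith
      with less.prems less.IH[OF a _ exists(2)] obtain \<psi> where \<psi>: "goedel_number \<psi> = a"
        "existential \<psi>" "free_vars \<psi> \<subseteq> {i. i \<le> e \<and> pr a i \<in> FV}" "a \<in> W \<longrightarrow> satisfies H v \<psi>"
        by auto
      have "satisfies H v (Exists j \<psi>)" if "satisfies H v \<psi>"
        using that v by (auto intro!: bexI[of _ "v j"])
      with \<psi> exists show ?thesis
        by (intro exI[of _ "Exists j \<psi>"]) (auto intro: existential.intros simp del: satisfies.simps)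
    qed
  qed
  from sentence_cert have "e \<in> Exs" "e \<in> W" "\<forall>i\<le>e. \<not> pr e i \<in> FV" by blast+
  with ex[of e] obtain \<phi> where \<phi>: "goedel_number \<phi> = e" "existential \<phi>" "free_vars \<phi> = {}"
    "satisfies H v \<phi>" by auto
  then have "true_in H \<phi>"
    unfolding true_in_def using satisfies_cong[of \<phi>] by blast
  with \<phi> show ?thesis unfolding existential_theory_def by blast
qed

section \<open>Completeness of certificates\<close>

text \<open>The intended sets are cut off at \<open>e\<close>. Subformulas have no larger codes, so
  nothing relevant is lost, and the cut makes the sets finite and thus codable.\<close>

lemma syntax_cert_complete:
  assumes \<phi>: "existential \<phi>" "free_vars \<phi> = {}" "satisfies H v (matrix \<phi>)"
    and e: "e = goedel_number \<phi>"
  obtains Tm Qf Exs W FT FV where "syntax_cert e Tm Qf Exs W FT FV"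
    "finite Tm" "finite Qf" "finite Exs" "finite W" "finite FT" "finite FV"
    "\<And>c. c \<in> Qf \<Longrightarrow> \<exists>\<psi>. quantifier_free \<psi> \<and> c = goedel_number \<psi>"
    "\<And>\<psi>. goedel_number \<psi> \<in> W \<longleftrightarrow> goedel_number \<psi> \<le> e \<and> satisfies H v (matrix \<psi>)"
proof -
  define Tm where "Tm = {c. c \<le> e \<and> (\<exists>t. c = code_term t)}"
  define Qf where "Qf = {c. c \<le> e \<and> (\<exists>\<psi>. quantifier_free \<psi> \<and> c = goedel_number \<psi>)}"
  define Exs where "Exs = {c. c \<le> e \<and> (\<exists>\<psi>. existential \<psi> \<and> c = goedel_number \<psi>)}"
  \<comment> \<open>\<open>Exists i \<psi>\<close> and \<open>\<psi>\<close> have the same matrix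
    and hence, under the single assignment \<open>v\<close>, the same entry.\<close>
  define W where "W = {c. c \<le> e \<and> (\<exists>\<psi>. satisfies H v (matrix \<psi>) \<and> c = goedel_number \<psi>)}"
  define FT where "FT = (\<lambda>(c, i). pr c i) ` {(c, i). c \<le> e \<and> i \<le> e \<and> (\<exists>t. c = code_term t \<and> i \<in> vars_term t)}"
  define FV where "FV = (\<lambda>(c, i). pr c i) ` {(c, i). c \<le> e \<and> i \<le> e \<and> (\<exists>\<psi>. c = goedel_number \<psi> \<and> i \<in> free_vars \<psi>)}"
  have Tm: "code_term t \<in> Tm \<longleftrightarrow> code_term t \<le> e" for t by (auto simp: Tm_def)
  have Qf: "goedel_number \<psi> \<in> Qf \<longleftrightarrow> goedel_number \<psi> \<le> e \<and> quantifier_free \<psi>" for \<psi>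
    by (auto simp: Qf_def goedel_number_inject)
  have Exs: "goedel_number \<psi> \<in> Exs \<longleftrightarrow> goedel_number \<psi> \<le> e \<and> existential \<psi>" for \<psi>
    by (auto simp: Exs_def goedel_number_inject)
  have W: "goedel_number \<psi> \<in> W \<longleftrightarrow> goedel_number \<psi> \<le> e \<and> satisfies H v (matrix \<psi>)" for \<psi>
    by (auto simp: W_def goedel_number_inject)
  have FT: "pr (code_term t) i \<in> FT \<longleftrightarrow> code_term t \<le> e \<and> i \<le> e \<and> i \<in> vars_term t" for t i
    by (auto simp: FT_def code_term_inject image_iff)
  have FV: "pr (goedel_number \<psi>) i \<in> FV \<longleftrightarrow> goedel_number \<psi> \<le> e \<and> i \<le> e \<and> i \<in> free_vars \<psi>" for \<psi> i
    by (auto simp: FV_def goedel_number_inject image_iff)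
  have sub: "a \<le> e" "b \<le> e" if "pr k (pr a b) \<le> e" for k a b
    using that le_prod_encode_2[of "pr a b" k] le_prod_encode_1[of a b] le_prod_encode_2[of b a]
    by linarith+
  have sub1: "a \<le> e" if "pr k a \<le> e" for k a
    using that le_prod_encode_2[of a k] by linarith
  have "syntax_cert e Tm Qf Exs W FT FV"
    unfolding syntax_cert_def
  proof (intro conjI allI impI, goal_cases)
    case (1 c)
    then obtain t where t: "c = code_term t" by (auto simp: Tm_def)
    show ?case
    proof (cases t)
      case (Var i)
      then have "pr c i \<in> FT" using t FT[of t i] 1(1) sub1[of 0 i] by simp
      with 1(1) t Var sub1[of 0 i] show ?thesis by auto
    next
      case One
      then show ?thesis using t by simp
    next
      case (Times s u)
      then have c: "c = pr 2 (pr (code_term s) (code_term u))" using t by simp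
      have *: "code_term s \<le> e" "code_term u \<le> e" using 1(1) sub unfolding c by blast+
      have fv: "\<forall>i\<le>e. pr (code_term s) i \<in> FT \<or> pr (code_term u) i \<in> FT \<longrightarrow> pr c i \<in> FT"
        using 1(1) unfolding t FT by (auto simp: Times)
      show ?thesis
        by (rule disjI2, rule disjI2, rule disjI1, rule ex_leI[OF *(1)], rule ex_leI[OF *(2)])
          (intro conjI c fv Tm[THEN iffD2] *)
    next
      case (Inverse s)
      then have c: "c = pr 3 (code_term s)" using t by simp
      have *: "code_term s \<le> e" using 1(1) sub1 unfolding c by blast
      have fv: "\<forall>i\<le>e. pr (code_term s) i \<in> FT \<longrightarrow> pr c i \<in> FT"
        using 1(1) unfolding t FT by (auto simp: Inverse)
      show ?thesis
        by (rule disjI2, rule disjI2, rule disjI2, rule ex_leI[OF *])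
          (intro conjI c fv Tm[THEN iffD2] *)
    qed
  next
    case (2 c)
    then obtain \<psi> where \<psi>: "c = goedel_number \<psi>" "quantifier_free \<psi>" by (auto simp: Qf_def)
    show ?case
    proof (cases \<psi>)
      case (Eq s t)
      then have c: "c = pr 0 (pr (code_term s) (code_term t))" using \<psi> by simp
      have *: "code_term s \<le> e" "code_term t \<le> e" using 2(1) sub unfolding c by blast+
      have fv: "\<forall>i\<le>e. pr (code_term s) i \<in> FT \<or> pr (code_term t) i \<in> FT \<longrightarrow> pr c i \<in> FV"
        using 2(1) unfolding \<psi>(1) FT FV by (auto simp: Eq)
      show ?thesis
        by (rule disjI1, rule ex_leI[OF *(1)], rule ex_leI[OF *(2)])
          (intro conjI c fv Tm[THEN iffD2] *)
    next
      case (Neg \<chi>)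
      then have c: "c = pr 1 (goedel_number \<chi>)" using \<psi> by simp
      have *: "goedel_number \<chi> \<le> e" using 2(1) sub1 unfolding c by blast
      have q: "quantifier_free \<chi>" using \<psi>(2) Neg by simp
      from q have w: "c \<in> W \<longleftrightarrow> \<not> goedel_number \<chi> \<in> W"
        using 2(1) * matrix_quantifier_free[of \<chi>] unfolding \<psi>(1) W by (simp add: Neg)
      have fv: "\<forall>i\<le>e. pr (goedel_number \<chi>) i \<in> FV \<longrightarrow> pr c i \<in> FV"
        using 2(1) unfolding \<psi>(1) FV by (auto simp: Neg)
      show ?thesis
        by (rule disjI2, rule disjI1, rule ex_leI[OF *])
          (intro conjI c w fv Qf[THEN iffD2] * q)
    next
      case (Conj \<chi> \<xi>)
      then have c: "c = pr 2 (pr (goedel_number \<chi>) (goedel_number \<xi>))" using \<psi> by simp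
      have *: "goedel_number \<chi> \<le> e" "goedel_number \<xi> \<le> e" using 2(1) sub unfolding c by blast+
      have q: "quantifier_free \<chi>" "quantifier_free \<xi>" using \<psi>(2) Conj by simp_all
      from q have w: "c \<in> W \<longleftrightarrow> goedel_number \<chi> \<in> W \<and> goedel_number \<xi> \<in> W"
        using 2(1) * matrix_quantifier_free[of \<chi>] matrix_quantifier_free[of \<xi>]
        unfolding \<psi>(1) W by (simp add: Conj)
      have fv: "\<forall>i\<le>e. pr (goedel_number \<chi>) i \<in> FV \<or> pr (goedel_number \<xi>) i \<in> FV \<longrightarrow> pr c i \<in> FV"
        using 2(1) unfolding \<psi>(1) FV by (auto simp: Conj)
      show ?thesis
        by (rule disjI2, rule disjI2, rule disjI1, rule ex_leI[OF *(1)], rule ex_leI[OF *(2)])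
          (intro conjI c w fv Qf[THEN iffD2] * q)
    next
      case (Disj \<chi> \<xi>)
      then have c: "c = pr 3 (pr (goedel_number \<chi>) (goedel_number \<xi>))" using \<psi> by simp
      have *: "goedel_number \<chi> \<le> e" "goedel_number \<xi> \<le> e" using 2(1) sub unfolding c by blast+
      have q: "quantifier_free \<chi>" "quantifier_free \<xi>" using \<psi>(2) Disj by simp_all
      from q have w: "c \<in> W \<longleftrightarrow> goedel_number \<chi> \<in> W \<or> goedel_number \<xi> \<in> W"
        using 2(1) * matrix_quantifier_free[of \<chi>] matrix_quantifier_free[of \<xi>]
        unfolding \<psi>(1) W by (simp add: Disj)
      have fv: "\<forall>i\<le>e. pr (goedel_number \<chi>) i \<in> FV \<or> pr (goedel_number \<xi>) i \<in> FV \<longrightarrow> pr c i \<in> FV"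
        using 2(1) unfolding \<psi>(1) FV by (auto simp: Disj)
      show ?thesis
        by (rule disjI2, rule disjI2, rule disjI2, rule ex_leI[OF *(1)], rule ex_leI[OF *(2)])
          (intro conjI c w fv Qf[THEN iffD2] * q)
    qed (use \<psi>(2) in simp_all)
  next
    case (3 c)
    then obtain \<psi> where \<psi>: "c = goedel_number \<psi>" "existential \<psi>" by (auto simp: Exs_def)
    from \<psi>(2) show ?case
    proof cases
      case 1
      then show ?thesis using 3(1) Qf[of \<psi>] \<psi>(1) by simp
    next
      case (2 \<chi> j)
      then have c: "c = pr 4 (pr j (goedel_number \<chi>))" using \<psi> by simp
      have *: "j \<le> e" "goedel_number \<chi> \<le> e" using 3(1) sub unfolding c by blast+
      have w: "c \<in> W \<longleftrightarrow> goedel_number \<chi> \<in> W"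
        using 3(1) * unfolding \<psi>(1) W by (simp add: 2)
      have fv: "\<forall>i\<le>e. pr (goedel_number \<chi>) i \<in> FV \<and> \<not> i = j \<longrightarrow> pr c i \<in> FV"
        using 3(1) unfolding \<psi>(1) FV by (auto simp: 2)
      show ?thesis
        by (rule disjI2, rule ex_leI[OF *(1)], rule ex_leI[OF *(2)])
          (intro conjI c w fv Exs[THEN iffD2] * 2(2))
    qed
  next
    case 4
    then show ?case using \<phi> e Exs by simp
  next
    case 5
    then show ?case using \<phi> e W by simp
  next
    case (6 i)
    then show ?case using \<phi>(2) FV unfolding e by simp
  qed
  moreover have "finite Tm" "finite Qf" "finite Exs" "finite W"
    unfolding Tm_def Qf_def Exs_def W_def by simp_all
  moreover have "finite FT" "finite FV"
    unfolding FT_def FV_def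
    by (rule finite_imageI, rule finite_subset[of _ "{..e} \<times> {..e}"], auto)+
  moreover have "\<exists>\<psi>. quantifier_free \<psi> \<and> c = goedel_number \<psi>" if "c \<in> Qf" for c
    using that by (auto simp: Qf_def)
  ultimately show thesis using that W by blast
qed

text \<open>\<open>k\<close> is fixed before the stage: it exceeds an argument of disagreement for
  every false equation coded up to \<open>e\<close>. \<open>Q\<close> is the true graph of the terms
  under \<open>v\<close>, cut to the box below the stage.\<close>

lemma graph_cert_complete:
  assumes v: "range v \<subseteq> G"
    and Qf: "\<And>c. c \<in> Qf \<Longrightarrow> \<exists>\<psi>. quantifier_free \<psi> \<and> c = goedel_number \<psi>"
    and W: "\<And>\<psi>. goedel_number \<psi> \<in> W \<longleftrightarrow> goedel_number \<psi> \<le> e \<and> satisfies H v (matrix \<psi>)"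
  shows "\<exists>k. \<forall>n bnd. level (perm_tree G) (Suc n) \<subseteq> {..<bnd} \<longrightarrow>
    (\<exists>q<2 ^ Suc (pr e (pr (Suc n) (Suc n))). graph_cert (perm_tree G) e k Qf W (Suc n) bnd (set_decode q))"
proof -
  \<comment> \<open>One argument per code is enough, since at most one pair of terms has the code
    \<open>c\<close>.\<close>
  have "\<exists>m. \<forall>s t. c = pr 0 (pr (code_term s) (code_term t)) \<and> term_value H v s \<noteq> term_value H v t \<longrightarrow>
      term_value H v s m \<noteq> term_value H v t m" for c
  proof (cases "\<exists>s t. c = pr 0 (pr (code_term s) (code_term t)) \<and> term_value H v s \<noteq> term_value H v t")
    case True
    then obtain s t m where st: "c = pr 0 (pr (code_term s) (code_term t))"
      "term_value H v s m \<noteq> term_value H v t m" by (auto simp: fun_eq_iff)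
    have "s' = s \<and> t' = t" if "c = pr 0 (pr (code_term s') (code_term t'))" for s' t'
      using that st(1) by (simp add: code_term_inject)
    with st(2) show ?thesis by blast
  qed blast
  then obtain w where w: "\<And>s t. term_value H v s \<noteq> term_value H v t \<Longrightarrow>
      term_value H v s (w (pr 0 (pr (code_term s) (code_term t)))) \<noteq>
      term_value H v t (w (pr 0 (pr (code_term s) (code_term t))))"
    by metis
  define k where "k = Suc (\<Sum>c\<le>e. w c)"
  have wk: "w c < k" if "c \<le> e" for c
    using member_le_sum[of c "{..e}" w] that by (simp add: k_def less_Suc_eq_le)
  show ?thesis
  proof (rule exI[of _ k], intro allI impI)
    fix n bnd assume bnd: "level (perm_tree G) (Suc n) \<subseteq> {..<bnd}"
    define Q where "Q = (\<lambda>(c, m, u). pr c (pr m u)) `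
      {(c, m, u). c \<le> e \<and> m < Suc n \<and> u < Suc n \<and> (\<exists>t. c = code_term t \<and> term_value H v t m = u)}"
    have Q: "pr c (pr m u) \<in> Q \<longleftrightarrow> c \<le> e \<and> m < Suc n \<and> u < Suc n \<and>
        (\<exists>t. c = code_term t \<and> term_value H v t m = u)" for c m u
      by (auto simp: Q_def image_iff)
    \<comment> \<open>The pairing is monotone, so \<open>pr e (pr (Suc n) (Suc n))\<close> bounds
      all triples; hence the exponent in the range of \<open>q\<close>.\<close>
    have Qsub: "Q \<subseteq> {..<Suc (pr e (pr (Suc n) (Suc n)))}"
      unfolding Q_def by (auto simp: less_Suc_eq_le intro!: prod_encode_mono)
    then have "finite Q" by (rule finite_subset) simp
    have "graph_cert (perm_tree G) e k Qf W (Suc n) bnd Q"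
      unfolding graph_cert_def
    proof (intro conjI allI impI, goal_cases)
      case (1 i)
      let ?s = "list_encode (perm_string (v i) n)"
      have lev: "?s \<in> level (perm_tree G) (Suc n)" using v by (auto simp: level_perm_tree_iff)
      have "nth_code ?s (2 * m) = v i m" if "m < Suc n" for m
        using that nth_code_eq[of "2 * m" ?s] nth_perm_string[of m n "v i"]
        by (simp add: length_perm_string)
      moreover have "pr (pr 0 i) (pr m (v i m)) \<in> Q" if "m < Suc n" "v i m < Suc n" for m
        unfolding Q using that 1 by (auto intro!: exI[of _ "Var i"])
      ultimately show ?case using lev bnd by (intro exI[of _ ?s]) auto
    next
      case (2 m)
      then show ?case unfolding Q using term_value_profinite(1)[OF v]
        by (auto intro!: exI[of _ One] simp del: term_value.simps)
    next
      case (3 a b m j u)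
      then obtain s t where "b = code_term t" "term_value H v t m = j"
        "a = code_term s" "term_value H v s j = u" unfolding Q by blast
      then show ?case unfolding Q using 3 term_value_profinite(2)[OF v, of s t m]
        by (auto intro!: exI[of _ "Times s t"] simp del: term_value.simps)
    next
      case (4 a m j)
      then obtain t where "a = code_term t" "term_value H v t j = m" unfolding Q by blast
      then show ?case unfolding Q using 4 term_value_profinite(3)[OF v, of t j]
        by (auto intro!: exI[of _ "Inverse t"] simp del: term_value.simps)
    next
      case (5 a b m u u')
      then obtain s t where st: "a = code_term s" "term_value H v s m = u"
        "b = code_term t" "term_value H v t m = u'" unfolding Q by blast
      have "goedel_number (Eq s t) \<in> W" using 5 st by simp
      then have "term_value H v s = term_value H v t" unfolding W by simp
      with st show ?case by simp
    next
      case (6 a b)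
      from 6 Qf obtain \<psi> where \<psi>: "quantifier_free \<psi>" "pr 0 (pr a b) = goedel_number \<psi>" by blast
      from \<psi>(2) obtain s t where st: "a = code_term s" "b = code_term t"
        by (cases \<psi>) auto
      have "\<not> goedel_number (Eq s t) \<in> W" using 6 st by simp
      then have "term_value H v s \<noteq> term_value H v t" unfolding W using 6 st by simp
      from w[OF this] have ne: "term_value H v s (w (pr 0 (pr a b))) \<noteq> term_value H v t (w (pr 0 (pr a b)))"
        unfolding st .
      have "\<not> (\<exists>u<Suc n. pr a (pr (w (pr 0 (pr a b))) u) \<in> Q \<and> pr b (pr (w (pr 0 (pr a b))) u) \<in> Q)"
        unfolding Q using ne by (auto simp: st code_term_inject)
      moreover have "w (pr 0 (pr a b)) < k" using 6 wk by blast
      ultimately show ?case by blast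
    qed
    with \<open>finite Q\<close> set_encode_less[OF Qsub]
    show "\<exists>q<2 ^ Suc (pr e (pr (Suc n) (Suc n))).
        graph_cert (perm_tree G) e k Qf W (Suc n) bnd (set_decode q)"
      by (intro exI[of _ "set_encode Q"]) (simp add: set_encode_inverse)
  qed
qed

section \<open>The Sigma-2 form of the existential theory\<close>

text \<open>
  The number \<open>x\<close> codes the list \<open>[k, Tm, Qf, Exs, W, FT, FV]\<close>. Stages start at 1, as there are no nodes of
  length 0.
\<close>

definition stage_check :: "nat \<Rightarrow> nat \<Rightarrow> nat \<Rightarrow> bool" where
  "stage_check e x y \<longleftrightarrow>
    syntax_cert e (set_decode (nth_code x 1)) (set_decode (nth_code x 2)) (set_decode (nth_code x 3))
      (set_decode (nth_code x 4)) (set_decode (nth_code x 5)) (set_decode (nth_code x 6)) \<and>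
    (\<exists>q<2 ^ Suc (pr e (pr (Suc y) (Suc y))).
      graph_cert (perm_tree G) e (nth_code x 0) (set_decode (nth_code x 2)) (set_decode (nth_code x 4))
        (Suc y) (LEAST b. level_bound (perm_tree G) y b) (set_decode q))"

text \<open>The unbounded guess \<open>x\<close> holds only data independent of the stage; the nodes
  and \<open>Q\<close> vary with \<open>y\<close> and stay within bounded quantifiers.\<close>

lemma goedel_existential_theory_iff:
  "e \<in> goedel_number ` existential_theory H \<longleftrightarrow> (\<exists>x. \<forall>y. stage_check e x y)"
proof
  assume "\<exists>x. \<forall>y. stage_check e x y"
  then obtain x where x: "\<And>y. stage_check e x y" by blast
  from x have "\<forall>y. \<exists>q. graph_cert (perm_tree G) e (nth_code x 0) (set_decode (nth_code x 2))
      (set_decode (nth_code x 4)) (Suc y) (LEAST b. level_bound (perm_tree G) y b) (set_decode q)"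
    unfolding stage_check_def by blast
  then obtain q where "\<And>y. graph_cert (perm_tree G) e (nth_code x 0) (set_decode (nth_code x 2))
      (set_decode (nth_code x 4)) (Suc y) (LEAST b. level_bound (perm_tree G) y b) (set_decode (q y))"
    by metis
  moreover from x have "syntax_cert e (set_decode (nth_code x 1)) (set_decode (nth_code x 2))
      (set_decode (nth_code x 3)) (set_decode (nth_code x 4)) (set_decode (nth_code x 5))
      (set_decode (nth_code x 6))"
    unfolding stage_check_def by blast
  ultimately show "e \<in> goedel_number ` existential_theory H" by (rule cert_sound[rotated])
next
  assume "e \<in> goedel_number ` existential_theory H"
  then obtain \<phi> where \<phi>: "e = goedel_number \<phi>" "existential \<phi>" "free_vars \<phi> = {}" "true_in H \<phi>"
    unfolding existential_theory_def by blast
  \<comment> \<open>\<open>true_in\<close> is universal over assignments; the constant identity is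
    one to start from.\<close>
  have "range (\<lambda>_::nat. \<one>\<^bsub>H\<^esub>) \<subseteq> carrier H"
    using subgroup.one_closed[of G S_infty] G
    by (auto simp: profinite_subgroup_def)
  with \<phi>(2,4) obtain v where v: "range v \<subseteq> carrier H" "satisfies H v (matrix \<phi>)"
    unfolding true_in_def using satisfies_matrix by metis
  obtain Tm Qf Exs W FT FV where syn: "syntax_cert e Tm Qf Exs W FT FV"
    and fin: "finite Tm" "finite Qf" "finite Exs" "finite W" "finite FT" "finite FV"
    and Qf: "\<And>c. c \<in> Qf \<Longrightarrow> \<exists>\<psi>. quantifier_free \<psi> \<and> c = goedel_number \<psi>"
    and W: "\<And>\<psi>. goedel_number \<psi> \<in> W \<longleftrightarrow> goedel_number \<psi> \<le> e \<and> satisfies H v (matrix \<psi>)"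
    by (rule syntax_cert_complete[OF \<phi>(2,3) v(2) \<phi>(1)]) blast
  have vG: "range v \<subseteq> G" using v(1) by simp
  obtain k where k: "\<forall>n bnd. level (perm_tree G) (Suc n) \<subseteq> {..<bnd} \<longrightarrow>
      (\<exists>q<2 ^ Suc (pr e (pr (Suc n) (Suc n))).
        graph_cert (perm_tree G) e k Qf W (Suc n) bnd (set_decode q))"
    using graph_cert_complete[OF vG Qf W] by (rule exE)
  define xs where
    "xs = [k, set_encode Tm, set_encode Qf, set_encode Exs, set_encode W, set_encode FT, set_encode FV]"
  have "nth_code (list_encode xs) i = xs ! i" if "i < 7" for i
    using nth_code_eq[of i "list_encode xs"] that by (simp add: xs_def del: list_encode.simps)
  from this[of 0] this[of 1] this[of 2] this[of 3] this[of 4] this[of 5] this[of 6]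
  have "nth_code (list_encode xs) 0 = k" "set_decode (nth_code (list_encode xs) 1) = Tm"
    "set_decode (nth_code (list_encode xs) 2) = Qf" "set_decode (nth_code (list_encode xs) 3) = Exs"
    "set_decode (nth_code (list_encode xs) 4) = W" "set_decode (nth_code (list_encode xs) 5) = FT"
    "set_decode (nth_code (list_encode xs) 6) = FV"
    by (simp_all add: xs_def set_encode_inverse fin del: list_encode.simps)
  note x = this
  \<comment> \<open>The least bound satisfies \<open>level_bound\<close>, hence exceeds all codes on
    level \<open>Suc y\<close>.\<close>
  have "stage_check e (list_encode xs) y" for y
    unfolding stage_check_def x
    using syn k[rule_format, OF level_less_of_bound[OF G LeastI_ex[OF ex_level_bound[OF G]] order_refl]]
    by (rule conjI)
  then show "\<exists>x. \<forall>y. stage_check e x y" by blast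
qed

lemma computable_Least_level_bound:
  assumes "computable_in (tree_oracle (perm_tree G)) a"
  shows "computable_in (tree_oracle (perm_tree G)) (\<lambda>e. LEAST b. level_bound (perm_tree G) (a e) b)"
proof -
  have "computable_in (tree_oracle (perm_tree G)) (\<lambda>e. LEAST b. level_bound (perm_tree G) (e 0) b)"
    by (intro computable_Least computable ex_level_bound[OF G])
  from computable_app1[OF this assms] show ?thesis .
qed

text \<open>All quantifiers in a stage are bounded, so decidability follows the syntax of the
  unfolded definitions.\<close>

lemma decidable_stage_check: "decidable3_in (tree_oracle (perm_tree G)) stage_check"
  by (rule decidable3_inI, unfold stage_check_def syntax_cert_def graph_cert_def)
    (intro computable computable_Least_level_bound)

end

theorem theorem2:
  fixes G :: "(nat \<Rightarrow> nat) set"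
  assumes "profinite_subgroup G"
  shows "Sigma02_in_degree (deg_tree (perm_tree G))
           (goedel_number ` existential_theory (S_infty\<lparr>carrier := G\<rparr>))"
proof -
  interpret profinite_perm_group G by (rule profinite_perm_group.intro) (rule assms)
  have "goedel_number ` existential_theory H = {e. \<exists>x. \<forall>y. stage_check e x y}"
    using goedel_existential_theory_iff by blast
  with decidable_stage_check show ?thesis
    unfolding deg_tree_def Sigma02_in_degree_iff Sigma02_in_def by blast
qed

end
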